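(* Let $X\in\{S,A\}$ be a data inflow policy (complete or anonymized). Data intermediation with inflow policy $X$ is profitable, i.e. $R(X)\ge 0$, if and only if $3\,G(X_{-i})\ge G(X)$.
   Context: There are $N\ge 2$ consumers, one producer and one data intermediary. The vectors $w=(w_1,\dots,w_N)$ (willingness to pay) and $e=(e_1,\dots,e_N)$ (errors) are independent of each other, each is exchangeable, with $\mathbb E[w_i]=\mu$, $\operatorname{var}[w_i]=1$, $\mathbb E[e_i]=0$, $\operatorname{var}[e_i]=1$. Consumer $i$ observes $s_i=w_i+\sigma e_i$, $\sigma>0$; $S_i$ denotes the information $s_i$. Inflow policies: complete data $X=S=(s_1,\dots,s_N)$, with $X_{-i}=S_{-i}=(s_j)_{j\ne i}$; anonymized data $X=A$, a uniformly random permutation (independent of everything else) of the entries of $S$, with $X_{-i}=A_{-i}$ a uniformly random permutation of the entries of $S_{-i}$. $\varnothing$ denotes no information. Product market: facing unit price $p_i$ consumer $i$ buys $q_i\in\mathbb R$ with utility $w_iq_i-p_iq_i-\tfrac12q_i^2$; the producer's profit from $i$ is $(p_i-c)q_i$, $c\ge 0$. When consumer $i$ has information $I$ and the producer has information $Y_0$ (no finer than $I$), $p_i^*=\tfrac12(\mathbb E[w_i\mid Y_0]+c)$, $q_i^*=\mathbb E[w_i\mid I]-p_i^*$; $\Pi_i(I,Y_0)=\mathbb E[(p_i^*-c)q_i^*]$ and $U_i(I,Y_0)=\mathbb E[w_iq_i^*-p_i^*q_i^*-\tfrac12(q_i^* )^2]$. Data market: all collected data are transmitted to the producer and to all consumers.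 The producer pays $m_0^*(X)=\sum_{i}\big(\Pi_i((S_i,X),X)-\Pi_i(S_i,\varnothing)\big)$; consumer $i$ is paid her marginal loss $m_i^*(X)=U_i((S_i,X_{-i}),X_{-i})-U_i((S_i,X),X)$ (if she refuses, only $X_{-i}$ is collected and it is still transmitted to everybody). The intermediary's profit is $R(X)=m_0^*(X)-\sum_i m_i^*(X)$. Gain function: $G(Y)=\operatorname{var}\big[\mathbb E[w_i\mid Y]\big]$; by symmetry $G(X)$ and $G(X_{-i})$ (each evaluated for consumer $i$) do not depend on $i$. *)

theory Defs
  imports "HOL-Probability.Probability" "HOL-Combinatorics.Combinatorics"
begin

definition random_vector :: "'i set \<Rightarrow> ('i \<Rightarrow> 'a \<Rightarrow> real) \<Rightarrow> 'a \<Rightarrow> 'i \<Rightarrow> real" where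
  "random_vector J v = (\<lambda>\<omega>. \<lambda>j\<in>J. v j \<omega>)"

definition exchangeable :: "'a measure \<Rightarrow> 'i set \<Rightarrow> ('i \<Rightarrow> 'a \<Rightarrow> real) \<Rightarrow> bool" where
  "exchangeable M J v \<longleftrightarrow>
     (\<forall>p. p permutes J \<longrightarrow>
        distr M (Pi\<^sub>M J (\<lambda>_. borel)) (random_vector J (\<lambda>j. v (p j)))
      = distr M (Pi\<^sub>M J (\<lambda>_. borel)) (random_vector J v))"

text \<open>Information is a sub-sigma-algebra of \<open>M\<close>, represented as a measure space with carrier
  \<open>space M\<close>; only its measurable sets matter.\<close>

definition vector_info :: "'a measure \<Rightarrow> 'i set \<Rightarrow> ('i \<Rightarrow> 'a \<Rightarrow> real) \<Rightarrow> 'a measure" where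
  "vector_info M J v = vimage_algebra (space M) (random_vector J v) (Pi\<^sub>M J (\<lambda>_. borel))"

definition no_info :: "'a measure \<Rightarrow> 'a measure" where
  "no_info M = sigma (space M) {}"

definition join_info :: "'a measure \<Rightarrow> 'a measure \<Rightarrow> 'a measure" where
  "join_info F H = sigma (space F) (sets F \<union> sets H)"

definition uniform_shuffle :: "'a measure \<Rightarrow> 'i set \<Rightarrow> ('a \<Rightarrow> 'i \<Rightarrow> 'i) \<Rightarrow> bool" where
  "uniform_shuffle M J p \<longleftrightarrow>
     p \<in> measurable M (count_space {q. q permutes J}) \<and>
     distr M (count_space {q. q permutes J}) p = uniform_count_measure {q. q permutes J}"

definition shuffle_info :: "'a measure \<Rightarrow> 'i set \<Rightarrow> ('a \<Rightarrow> 'i \<Rightarrow> 'i) \<Rightarrow> 'a measure" where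
  "shuffle_info M J p = vimage_algebra (space M) p (count_space {q. q permutes J})"

datatype inflow_policy = Complete | Anonymized

text \<open>The anonymized data are the signals read in the order given by a random permutation:
  \<open>\<tau>\<close> shuffles all consumers, and \<open>\<rho> i\<close> shuffles the consumers other than \<open>i\<close> when \<open>i\<close> refuses.
  The data sets \<open>A\<close> and \<open>A\<close> without \<open>i\<close> are never observed together, so each shuffle is only
  required to be independent of \<open>(w, e)\<close>; their joint law is unrestricted.\<close>

locale data_market = prob_space M
  for M :: "'a measure" +
  fixes N :: nat
    and w e :: "nat \<Rightarrow> 'a \<Rightarrow> real"
    and \<mu> \<sigma> c :: real
    and \<tau> :: "'a \<Rightarrow> nat \<Rightarrow> nat"
    and \<rho> :: "nat \<Rightarrow> 'a \<Rightarrow> nat \<Rightarrow> nat"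
  assumes N_ge_2: "N \<ge> 2"
    and \<sigma>_pos: "\<sigma> > 0"
    and c_nonneg: "c \<ge> 0"
    and w_moments: "\<And>i. i \<in> {1..N} \<Longrightarrow>
      integrable M (w i) \<and> integrable M (\<lambda>\<omega>. (w i \<omega>)\<^sup>2) \<and> expectation (w i) = \<mu> \<and> variance (w i) = 1"
    and e_moments: "\<And>i. i \<in> {1..N} \<Longrightarrow>
      integrable M (e i) \<and> integrable M (\<lambda>\<omega>. (e i \<omega>)\<^sup>2) \<and> expectation (e i) = 0 \<and> variance (e i) = 1"
    and w_exchangeable: "exchangeable M {1..N} w"
    and e_exchangeable: "exchangeable M {1..N} e"
    and w_e_indep: "indep_var (Pi\<^sub>M {1..N} (\<lambda>_. borel)) (random_vector {1..N} w)
                              (Pi\<^sub>M {1..N} (\<lambda>_. borel)) (random_vector {1..N} e)"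
    and \<tau>_uniform: "uniform_shuffle M {1..N} \<tau>"
    and \<tau>_indep: "indep_set
      (sets (join_info (vector_info M {1..N} w) (vector_info M {1..N} e)))
      (sets (shuffle_info M {1..N} \<tau>))"
    and \<rho>_uniform: "\<And>i. i \<in> {1..N} \<Longrightarrow> uniform_shuffle M ({1..N} - {i}) (\<rho> i)"
    and \<rho>_indep: "\<And>i. i \<in> {1..N} \<Longrightarrow> indep_set
      (sets (join_info (vector_info M {1..N} w) (vector_info M {1..N} e)))
      (sets (shuffle_info M ({1..N} - {i}) (\<rho> i)))"
begin

definition signal :: "nat \<Rightarrow> 'a \<Rightarrow> real" where
  "signal i \<omega> = w i \<omega> + \<sigma> * e i \<omega>"

definition own_info :: "nat \<Rightarrow> 'a measure" where
  "own_info i = vimage_algebra (space M) (signal i) borel"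

fun inflow :: "inflow_policy \<Rightarrow> 'a measure" where
  "inflow Complete = vector_info M {1..N} signal"
| "inflow Anonymized = vector_info M {1..N} (\<lambda>j \<omega>. signal (\<tau> \<omega> j) \<omega>)"

fun inflow_without :: "inflow_policy \<Rightarrow> nat \<Rightarrow> 'a measure" where
  "inflow_without Complete i = vector_info M ({1..N} - {i}) signal"
| "inflow_without Anonymized i = vector_info M ({1..N} - {i}) (\<lambda>j \<omega>. signal (\<rho> i \<omega> j) \<omega>)"

definition price :: "nat \<Rightarrow> 'a measure \<Rightarrow> 'a \<Rightarrow> real" where
  "price i Y \<omega> = (real_cond_exp M Y (w i) \<omega> + c) / 2"

definition demand :: "nat \<Rightarrow> 'a measure \<Rightarrow> 'a measure \<Rightarrow> 'a \<Rightarrow> real" where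
  "demand i F Y \<omega> = real_cond_exp M F (w i) \<omega> - price i Y \<omega>"

definition producer_profit :: "nat \<Rightarrow> 'a measure \<Rightarrow> 'a measure \<Rightarrow> real" where
  "producer_profit i F Y = expectation (\<lambda>\<omega>. (price i Y \<omega> - c) * demand i F Y \<omega>)"

definition consumer_surplus :: "nat \<Rightarrow> 'a measure \<Rightarrow> 'a measure \<Rightarrow> real" where
  "consumer_surplus i F Y = expectation (\<lambda>\<omega>.
     w i \<omega> * demand i F Y \<omega> - price i Y \<omega> * demand i F Y \<omega> - (demand i F Y \<omega>)\<^sup>2 / 2)"

definition producer_payment :: "inflow_policy \<Rightarrow> real" where
  "producer_payment X = (\<Sum>i\<in>{1..N}.
     producer_profit i (join_info (own_info i) (inflow X)) (inflow X)
     - producer_profit i (own_info i) (no_info M))"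

definition consumer_payment :: "inflow_policy \<Rightarrow> nat \<Rightarrow> real" where
  "consumer_payment X i =
     consumer_surplus i (join_info (own_info i) (inflow_without X i)) (inflow_without X i)
     - consumer_surplus i (join_info (own_info i) (inflow X)) (inflow X)"

definition intermediary_profit :: "inflow_policy \<Rightarrow> real" where
  "intermediary_profit X = producer_payment X - (\<Sum>i\<in>{1..N}. consumer_payment X i)"

definition gain :: "nat \<Rightarrow> 'a measure \<Rightarrow> real" where
  "gain i Y = variance (real_cond_exp M Y (w i))"

end

end

theory Submission
  imports Defs
begin

text \<open>If the consumer's information \<open>F\<close> refines the producer's information \<open>Y\<close>, the linear-quadratic
  payoffs are affine in gains: profit is \<open>G(Y)/4\<close> and surplus is \<open>G(F)/2 - 3 G(Y)/8\<close>, up to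
  constants in \<open>\<mu>\<close> and \<open>c\<close>. The intermediary's profit from \<open>i\<close> is therefore
  \<open>(3 G(X\<^sub>-\<^sub>i) - G(X))/8 - (G(S\<^sub>i, X\<^sub>-\<^sub>i) - G(S\<^sub>i, X))/2\<close>, and the last bracket vanishes: by exchangeability
  \<open>E[w\<^sub>i | S]\<close> is a function of \<open>S\<close> that is symmetric in the signals of the others, hence it is already
  determined by \<open>S\<^sub>i\<close> together with either \<open>X\<close> or \<open>X\<^sub>-\<^sub>i\<close>, whether anonymized or not. Exchangeability also makes the
  gains the same for all \<open>i\<close>, so the sum over consumers is \<open>N (3 G(X\<^sub>-\<^sub>i) - G(X))/8\<close>.\<close>

section \<open>Conditional expectations given random variables\<close>

text \<open>The delicate point is the posterior given the own signal and anonymized data. That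
  information also says something about the shuffle, so in general it is not contained in the
  information of S, and the tower property does not apply. Two facts replace it. First, the
  posterior must be measurable for the join, which calls for a version of E[w_i | S] that is
  symmetric at every point, not merely almost everywhere. Second, the join must tell no more about
  w_i than S does. This comes from independence: once the shuffle is frozen at one of its finitely
  many values, every event of the join becomes an event about S. The argument uses the shuffle only
  through independence, so the constant identity fits in as well. The law of the shuffle enters when
  gains are compared across consumers: shuffles that correspond under a relabelling must be equally
  likely, which holds for the uniform law and for the point mass at the identity.\<close>

lemma real_cond_exp_cong_sets:
  assumes "sets F = sets F'"
  shows "real_cond_exp M F f = real_cond_exp M F' f"
  using assms sets_eq_imp_space_eq[OF assms]
  by (simp add: real_cond_exp_def nn_cond_exp_def subalgebra_def restr_to_subalg_def cong: if_cong)

lemma subalgebra_vimage_algebra: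
  assumes "Y \<in> measurable M L"
  shows "subalgebra M (vimage_algebra (space M) Y L)"
  using sets_image_in_sets[OF refl assms] by (simp add: subalgebra_def)

lemma sets_vimage_algebra_measurable:
  assumes "Y \<in> measurable M L"
  shows "sets (vimage_algebra (space M) Y L) = {Y -` B \<inter> space M | B. B \<in> sets L}"
  using assms by (intro sets_vimage_algebra2) (auto dest: measurable_space)

lemma sets_vimage_algebra_eqI:
  assumes "Y \<in> measurable (vimage_algebra \<Omega> Z K) L" "Z \<in> measurable (vimage_algebra \<Omega> Y L) K"
  shows "sets (vimage_algebra \<Omega> Y L) = sets (vimage_algebra \<Omega> Z K)"
  using assms by (intro equalityI sets_image_in_sets) simp_all

text \<open>The Doob-Dynkin lemma. Level sets of simple approximations of \<open>f\<close> are
  preimages under \<open>Y\<close>, so each approximation factors through \<open>Y\<close>, and so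
  does the limit.\<close>

lemma measurable_vimage_algebra_factor:
  fixes f :: "'a \<Rightarrow> real"
  assumes f: "f \<in> borel_measurable (vimage_algebra \<Omega> Y L)"
    and Y: "Y \<in> \<Omega> \<rightarrow> space L"
  obtains \<psi> where "\<psi> \<in> borel_measurable L" "\<And>\<omega>. \<omega> \<in> \<Omega> \<Longrightarrow> f \<omega> = \<psi> (Y \<omega>)"
proof -
  let ?V = "vimage_algebra \<Omega> Y L"
  obtain s where s: "\<And>k. simple_function ?V (s k)"
    and lim_s: "\<And>\<omega>. \<omega> \<in> \<Omega> \<Longrightarrow> (\<lambda>k. s k \<omega>) \<longlonglongrightarrow> f \<omega>"
    using borel_measurable_implies_sequence_metric[OF f, of 0] by auto
  have fin: "finite (s k ` \<Omega>)" for k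
    using simple_functionD(1)[OF s] by simp
  have "\<exists>B. \<forall>k v. B k v \<in> sets L \<and> s k -` {v} \<inter> \<Omega> = Y -` B k v \<inter> \<Omega>"
  proof -
    have "\<exists>B. B \<in> sets L \<and> s k -` {v} \<inter> \<Omega> = Y -` B \<inter> \<Omega>" for k v
      using simple_functionD(2)[OF s, of k "{v}"] by (auto simp: sets_vimage_algebra2[OF Y])
    then show ?thesis by metis
  qed
  then obtain B where "\<forall>k v. B k v \<in> sets L \<and> s k -` {v} \<inter> \<Omega> = Y -` B k v \<inter> \<Omega>" ..
  then have B: "B k v \<in> sets L" and sB: "s k -` {v} \<inter> \<Omega> = Y -` B k v \<inter> \<Omega>" for k v
    by simp_all
  \<comment> \<open>Off the range of \<open>Y\<close> the sets \<open>B k v\<close> may overlap and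
    \<open>r k\<close> may diverge. Only values at points \<open>Y \<omega>\<close> matter, and
    \<open>lim\<close> is total and still measurable.\<close>
  define r where "r k y = (\<Sum>v\<in>s k ` \<Omega>. v * indicator (B k v) y)" for k y
  have r: "r k (Y \<omega>) = s k \<omega>" if "\<omega> \<in> \<Omega>" for k \<omega>
  proof -
    have "Y \<omega> \<in> B k v \<longleftrightarrow> v = s k \<omega>" for v
      using sB[of k v] that by (auto simp: set_eq_iff)
    then have "r k (Y \<omega>) = (\<Sum>v\<in>s k ` \<Omega>. if v = s k \<omega> then v else 0)"
      unfolding r_def by (intro sum.cong) (auto simp: indicator_def)
    then show ?thesis using that fin by simp
  qed
  have [measurable]: "B k v \<in> sets L" for k v by (rule B)
  have "(\<lambda>y. lim (\<lambda>k. r k y)) \<in> borel_measurable L"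
    unfolding r_def by measurable
  moreover have "f \<omega> = lim (\<lambda>k. r k (Y \<omega>))" if "\<omega> \<in> \<Omega>" for \<omega>
    using limI[OF lim_s[OF that]] by (simp add: r that)
  ultimately show thesis by (rule that)
qed

text \<open>Makes joint information the information of a single pair-valued observation, so that
  every event of the join is the preimage of one set in the product space.\<close>

lemma sets_join_info_vimage_algebra:
  assumes X: "X \<in> \<Omega> \<rightarrow> space K" and Y: "Y \<in> \<Omega> \<rightarrow> space L"
  shows "sets (join_info (vimage_algebra \<Omega> X K) (vimage_algebra \<Omega> Y L)) =
    sets (vimage_algebra \<Omega> (\<lambda>\<omega>. (X \<omega>, Y \<omega>)) (K \<Otimes>\<^sub>M L))" (is "sets ?J = sets ?V")
proof (rule equalityI)
  have sub: "sets (vimage_algebra \<Omega> X K) \<union> sets (vimage_algebra \<Omega> Y L) \<subseteq> Pow \<Omega>"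
    using sets.sets_into_space[of _ "vimage_algebra \<Omega> X K"]
      sets.sets_into_space[of _ "vimage_algebra \<Omega> Y L"] by auto
  have sJ: "sets ?J = sigma_sets \<Omega> (sets (vimage_algebra \<Omega> X K) \<union> sets (vimage_algebra \<Omega> Y L))"
    and spJ: "space ?J = \<Omega>"
    using sub by (simp_all add: join_info_def)
  have XY: "(\<lambda>\<omega>. (X \<omega>, Y \<omega>)) \<in> measurable ?V (K \<Otimes>\<^sub>M L)"
    using X Y by (intro measurable_vimage_algebra1) (auto simp: space_pair_measure)
  have "X \<in> measurable ?V K" "Y \<in> measurable ?V L"
    using measurable_compose[OF XY measurable_fst] measurable_compose[OF XY measurable_snd] by simp_all
  then have "sets (vimage_algebra \<Omega> X K) \<union> sets (vimage_algebra \<Omega> Y L) \<subseteq> sets ?V"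
    using sets_image_in_sets[of ?V \<Omega> X K] sets_image_in_sets[of ?V \<Omega> Y L] by simp
  then show "sets ?J \<subseteq> sets ?V"
    unfolding sJ using sets.sigma_sets_subset[of _ ?V] by simp
  have "X \<in> measurable ?J K" "Y \<in> measurable ?J L"
    using X Y by (auto intro!: measurableI simp: spJ sJ in_vimage_algebra)
  then show "sets ?V \<subseteq> sets ?J"
    by (intro sets_image_in_sets) (auto simp: spJ intro!: measurable_Pair)
qed

section \<open>Transfer of conditional expectations between variables with the same joint
  law\<close>

context prob_space
begin

text \<open>The defining identity of a conditional expectation, tested on the event that
  \<open>Y\<close> lies in \<open>B\<close>, compares expectations of functions of the pair. It
  therefore carries over, with the same \<open>\<psi>\<close>, to any pair with the same joint
  law.\<close>

lemma real_cond_exp_factor_law: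
  assumes W: "integrable M W" and W': "integrable M W'"
    and Y: "Y \<in> measurable M L" and Y': "Y' \<in> measurable M L"
    and law: "distr M (borel \<Otimes>\<^sub>M L) (\<lambda>\<omega>. (W \<omega>, Y \<omega>)) = distr M (borel \<Otimes>\<^sub>M L) (\<lambda>\<omega>. (W' \<omega>, Y' \<omega>))"
    and \<psi>: "\<psi> \<in> borel_measurable L"
    and ae: "AE \<omega> in M. real_cond_exp M (vimage_algebra (space M) Y L) W \<omega> = \<psi> (Y \<omega>)"
  shows "AE \<omega> in M. real_cond_exp M (vimage_algebra (space M) Y' L) W' \<omega> = \<psi> (Y' \<omega>)"
proof -
  note [measurable] = Y Y' \<psi> borel_measurable_integrable[OF W] borel_measurable_integrable[OF W']
  let ?F = "vimage_algebra (space M) Y L" and ?F' = "vimage_algebra (space M) Y' L"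
  interpret F: finite_measure_subalgebra M ?F
    by unfold_locales (rule subalgebra_vimage_algebra[OF Y])
  interpret F': finite_measure_subalgebra M ?F'
    by unfold_locales (rule subalgebra_vimage_algebra[OF Y'])
  have transfer: "expectation (\<lambda>\<omega>. g (W \<omega>, Y \<omega>)) = expectation (\<lambda>\<omega>. g (W' \<omega>, Y' \<omega>))"
    if [measurable]: "g \<in> borel_measurable (borel \<Otimes>\<^sub>M L)" for g :: "real \<times> 'b \<Rightarrow> real"
    using arg_cong[OF law, of "\<lambda>D. integral\<^sup>L D g"] by (simp add: integral_distr)
  have int\<psi>: "integrable M (\<lambda>\<omega>. \<psi> (Y \<omega>))"
    using F.real_cond_exp_int(1)[OF W] ae
    by (subst integrable_cong_AE[where g = "real_cond_exp M ?F W"])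
      (auto intro: borel_measurable_integrable)
  have int\<psi>': "integrable M (\<lambda>\<omega>. \<psi> (Y' \<omega>))"
  proof -
    have "integrable (distr M (borel \<Otimes>\<^sub>M L) (\<lambda>\<omega>. (W \<omega>, Y \<omega>))) (\<lambda>z. \<psi> (snd z))"
      by (subst integrable_distr_eq) (simp_all add: int\<psi>)
    then show ?thesis
      unfolding law by (subst (asm) integrable_distr_eq) simp_all
  qed
  show ?thesis
  proof (rule F'.real_cond_exp_charact[OF _ W' int\<psi>'])
    fix A assume "A \<in> sets ?F'"
    then obtain B where B[measurable]: "B \<in> sets L" and A: "A = Y' -` B \<inter> space M"
      by (auto simp: sets_vimage_algebra_measurable[OF Y'])
    let ?A = "Y -` B \<inter> space M"
    have set_int: "(LINT \<omega>:Z -` B \<inter> space M|M. f \<omega>) = expectation (\<lambda>\<omega>. indicator B (Z \<omega>) * f \<omega>)"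
      for Z and f :: "'a \<Rightarrow> real"
      unfolding set_lebesgue_integral_def
      by (intro Bochner_Integration.integral_cong) (auto simp: indicator_def)
    have "?A \<in> sets ?F"
      using sets_vimage_algebra_measurable[OF Y] B by auto
    then have "(LINT \<omega>:?A|M. W \<omega>) = (LINT \<omega>:?A|M. real_cond_exp M ?F W \<omega>)"
      by (rule F.real_cond_exp_intA[OF W])
    also have "\<dots> = (LINT \<omega>:?A|M. \<psi> (Y \<omega>))"
      using ae by (intro set_lebesgue_integral_cong_AE) auto
    finally show "(LINT \<omega>:A|M. W' \<omega>) = (LINT \<omega>:A|M. \<psi> (Y' \<omega>))"
      using transfer[of "\<lambda>z. indicator B (snd z) * fst z"]
        transfer[of "\<lambda>z. indicator B (snd z) * \<psi> (snd z)"]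
      by (simp add: A set_int)
  next
    show "(\<lambda>\<omega>. \<psi> (Y' \<omega>)) \<in> borel_measurable ?F'"
      using measurable_space[OF Y'] by (intro measurable_compose[OF measurable_vimage_algebra1 \<psi>]) auto
  qed
qed

lemma real_cond_exp_factor:
  assumes "Y \<in> measurable M L"
  obtains \<psi> where "\<psi> \<in> borel_measurable L"
    "\<And>\<omega>. \<omega> \<in> space M \<Longrightarrow> real_cond_exp M (vimage_algebra (space M) Y L) W \<omega> = \<psi> (Y \<omega>)"
proof -
  have "Y \<in> space M \<rightarrow> space L" using measurable_space[OF assms] by auto
  from measurable_vimage_algebra_factor[OF borel_measurable_cond_exp this, of M W] that
  show thesis by blast
qed

lemma variance_cong_AE:
  fixes f g :: "'a \<Rightarrow> real"
  assumes [measurable]: "f \<in> borel_measurable M" "g \<in> borel_measurable M"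
    and "AE \<omega> in M. f \<omega> = g \<omega>"
  shows "variance f = variance g"
proof -
  have "expectation f = expectation g"
    using assms by (intro integral_cong_AE) auto
  then show ?thesis
    using assms by (intro integral_cong_AE) auto
qed

text \<open>One \<open>\<psi>\<close> represents both posteriors, and its mean and variance depend
  only on the law of its argument. Gains are thus determined by the joint law of target and
  data.\<close>

lemma variance_real_cond_exp_law:
  assumes W: "integrable M W" and W': "integrable M W'"
    and Y: "Y \<in> measurable M L" and Y': "Y' \<in> measurable M L"
    and law: "distr M (borel \<Otimes>\<^sub>M L) (\<lambda>\<omega>. (W \<omega>, Y \<omega>)) = distr M (borel \<Otimes>\<^sub>M L) (\<lambda>\<omega>. (W' \<omega>, Y' \<omega>))"
  shows "variance (real_cond_exp M (vimage_algebra (space M) Y L) W) =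
    variance (real_cond_exp M (vimage_algebra (space M) Y' L) W')"
proof -
  note [measurable] = Y Y' borel_measurable_integrable[OF W] borel_measurable_integrable[OF W']
  obtain \<psi> where \<psi>[measurable]: "\<psi> \<in> borel_measurable L"
    and eq: "\<And>\<omega>. \<omega> \<in> space M \<Longrightarrow> real_cond_exp M (vimage_algebra (space M) Y L) W \<omega> = \<psi> (Y \<omega>)"
    using real_cond_exp_factor[OF Y] by blast
  have ae': "AE \<omega> in M. real_cond_exp M (vimage_algebra (space M) Y' L) W' \<omega> = \<psi> (Y' \<omega>)"
    using real_cond_exp_factor_law[OF assms \<psi>] eq by auto
  have transfer: "expectation (\<lambda>\<omega>. g (Y \<omega>)) = expectation (\<lambda>\<omega>. g (Y' \<omega>))"
    if [measurable]: "g \<in> borel_measurable L" for g :: "'b \<Rightarrow> real"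
    using arg_cong[OF law, of "\<lambda>D. integral\<^sup>L D (\<lambda>z. g (snd z))"]
    by (simp add: integral_distr)
  have "variance (real_cond_exp M (vimage_algebra (space M) Y L) W) = variance (\<lambda>\<omega>. \<psi> (Y \<omega>))"
    using eq by (intro variance_cong_AE) auto
  also have "\<dots> = variance (\<lambda>\<omega>. \<psi> (Y' \<omega>))"
    using transfer[of \<psi>] transfer[of "\<lambda>y. (\<psi> y - expectation (\<lambda>\<omega>. \<psi> (Y' \<omega>)))\<^sup>2"] by simp
  also have "\<dots> = variance (real_cond_exp M (vimage_algebra (space M) Y' L) W')"
    using ae' by (intro variance_cong_AE) auto
  finally show ?thesis .
qed

section \<open>Second moments of conditional expectations\<close>

lemma integrable_real_cond_exp_power2:
  assumes "subalgebra M F" "integrable M f" "integrable M (\<lambda>\<omega>. (f \<omega>)\<^sup>2)"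
  shows "integrable M (\<lambda>\<omega>. (real_cond_exp M F f \<omega>)\<^sup>2)"
proof -
  interpret F: finite_measure_subalgebra M F by unfold_locales fact
  show ?thesis
    using assms by (intro F.integrable_convex_cond_exp[where I = UNIV]) (auto simp: convex_power2)
qed

lemma expectation_mult_real_cond_exp:
  fixes f g :: "'a \<Rightarrow> real"
  assumes "subalgebra M F"
    and f: "integrable M f" "integrable M (\<lambda>\<omega>. (f \<omega>)\<^sup>2)"
    and g: "g \<in> borel_measurable F" "integrable M (\<lambda>\<omega>. (g \<omega>)\<^sup>2)"
  shows "integrable M (\<lambda>\<omega>. g \<omega> * f \<omega>)"
    and "integrable M (\<lambda>\<omega>. g \<omega> * real_cond_exp M F f \<omega>)"
    and "expectation (\<lambda>\<omega>. g \<omega> * real_cond_exp M F f \<omega>) = expectation (\<lambda>\<omega>. g \<omega> * f \<omega>)"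
proof -
  interpret F: finite_measure_subalgebra M F by unfold_locales fact
  have [measurable]: "g \<in> borel_measurable M" "f \<in> borel_measurable M"
    using measurable_from_subalg[OF assms(1) g(1)] f(1) by auto
  show gf: "integrable M (\<lambda>\<omega>. g \<omega> * f \<omega>)"
  proof (rule Bochner_Integration.integrable_bound)
    show "integrable M (\<lambda>\<omega>. (g \<omega>)\<^sup>2 + (f \<omega>)\<^sup>2)" using f g by simp
    have "\<bar>x * y\<bar> \<le> x\<^sup>2 + y\<^sup>2" for x y :: real
    proof -
      have "0 \<le> \<bar>x\<bar> * \<bar>y\<bar>" "2 * (\<bar>x\<bar> * \<bar>y\<bar>) \<le> x\<^sup>2 + y\<^sup>2"
        using sum_squares_bound[of "\<bar>x\<bar>" "\<bar>y\<bar>"] by (simp_all add: mult.assoc)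
      then show ?thesis unfolding abs_mult by linarith
    qed
    then show "AE \<omega> in M. norm (g \<omega> * f \<omega>) \<le> norm ((g \<omega>)\<^sup>2 + (f \<omega>)\<^sup>2)" by simp
  qed simp
  show "integrable M (\<lambda>\<omega>. g \<omega> * real_cond_exp M F f \<omega>)"
    and "expectation (\<lambda>\<omega>. g \<omega> * real_cond_exp M F f \<omega>) = expectation (\<lambda>\<omega>. g \<omega> * f \<omega>)"
    using F.real_cond_exp_intg[OF gf g(1)] by simp_all
qed

text \<open>Both expectations equal that of E[f | Y] f: the factor E[f | Y] is measurable for
  \<open>F\<close> as well as for \<open>Y\<close>, so either conditioning on the other factor can
  be removed.\<close>

lemma expectation_real_cond_exp_nested:
  fixes f :: "'a \<Rightarrow> real"
  assumes F: "subalgebra M F" and Y: "subalgebra F Y"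
    and f: "integrable M f" "integrable M (\<lambda>\<omega>. (f \<omega>)\<^sup>2)"
  shows "integrable M (\<lambda>\<omega>. real_cond_exp M Y f \<omega> * real_cond_exp M F f \<omega>)"
    and "expectation (\<lambda>\<omega>. real_cond_exp M Y f \<omega> * real_cond_exp M F f \<omega>) =
      expectation (\<lambda>\<omega>. (real_cond_exp M Y f \<omega>)\<^sup>2)"
proof -
  have MY: "subalgebra M Y" using F Y by (auto simp: subalgebra_def)
  note E = integrable_real_cond_exp_power2[OF MY f]
  have EF: "real_cond_exp M Y f \<in> borel_measurable F"
    by (rule measurable_from_subalg[OF Y]) measurable
  show "integrable M (\<lambda>\<omega>. real_cond_exp M Y f \<omega> * real_cond_exp M F f \<omega>)"
    by (rule expectation_mult_real_cond_exp(2)[OF F f EF E])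
  show "expectation (\<lambda>\<omega>. real_cond_exp M Y f \<omega> * real_cond_exp M F f \<omega>) =
      expectation (\<lambda>\<omega>. (real_cond_exp M Y f \<omega>)\<^sup>2)"
    using expectation_mult_real_cond_exp(3)[OF F f EF E]
      expectation_mult_real_cond_exp(3)[OF MY f _ E]
    by (simp add: power2_eq_square)
qed

section \<open>Averaging over an independent variable with finitely many values\<close>

lemma indep_set_imp_indep_var:
  assumes indep: "indep_set (sets F) (sets H)"
    and F: "subalgebra M F" and H: "subalgebra M H"
    and X: "X \<in> measurable F K" and Y: "Y \<in> measurable H K"
  shows "indep_var K X K Y"
proof -
  have sub: "sigma_sets (space M) {Z -` A \<inter> space M |A. A \<in> sets K} \<subseteq> sets G"
    if "subalgebra M G" "Z \<in> measurable G K" for G and Z :: "'a \<Rightarrow> 'b"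
  proof -
    have "sigma_sets (space G) {Z -` A \<inter> space M |A. A \<in> sets K} \<subseteq> sets G"
      using that by (intro sets.sigma_sets_subset) (auto simp: subalgebra_def dest: measurable_sets)
    then show ?thesis using that(1) by (simp add: subalgebra_def)
  qed
  show ?thesis
    unfolding indep_var_eq
  proof (intro conjI)
    show "X \<in> measurable M K" "Y \<in> measurable M K"
      using measurable_from_subalg[OF F X] measurable_from_subalg[OF H Y] .
    show "indep_set (sigma_sets (space M) {X -` A \<inter> space M |A. A \<in> sets K})
        (sigma_sets (space M) {Y -` A \<inter> space M |A. A \<in> sets K})"
      using indep sub[OF F X] sub[OF H Y] unfolding indep_sets2_eq by (meson subset_iff)
  qed
qed

text \<open>Frozen at \<open>t = q\<close>, the integrand is measurable for \<open>F\<close> and so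
  independent of the event \<open>t = q\<close>; each term of the finite split factors. Independence
  of a shuffle is exploited through this formula.\<close>

lemma expectation_indep_finite:
  fixes g :: "'q \<Rightarrow> 'a \<Rightarrow> real"
  assumes F: "subalgebra M F"
    and t[measurable]: "t \<in> measurable M (count_space Q)" and fin: "finite Q"
    and indep: "indep_set (sets F) (sets (vimage_algebra (space M) t (count_space Q)))"
    and g: "\<And>q. q \<in> Q \<Longrightarrow> g q \<in> borel_measurable F"
    and int: "\<And>q. q \<in> Q \<Longrightarrow> integrable M (g q)"
  shows "expectation (\<lambda>\<omega>. g (t \<omega>) \<omega>) =
      (\<Sum>q\<in>Q. prob (t -` {q} \<inter> space M) * expectation (g q))"
proof -
  let ?H = "vimage_algebra (space M) t (count_space Q)"
  have H: "subalgebra M ?H" by (rule subalgebra_vimage_algebra[OF t])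
  have tH: "t \<in> measurable ?H (count_space Q)"
    using measurable_space[OF t] by (intro measurable_vimage_algebra1) auto
  have split: "g (t \<omega>) \<omega> = (\<Sum>q\<in>Q. g q \<omega> * indicator {q} (t \<omega>))"
    if "\<omega> \<in> space M" for \<omega>
  proof -
    have "t \<omega> \<in> Q" using measurable_space[OF t that] by simp
    moreover have "(\<Sum>q\<in>Q. g q \<omega> * indicator {q} (t \<omega>)) =
        (\<Sum>q\<in>Q. if q = t \<omega> then g q \<omega> else 0)"
      by (intro sum.cong) (auto simp: indicator_def)
    ultimately show ?thesis using fin by simp
  qed
  have prod: "integrable M (\<lambda>\<omega>. g q \<omega> * indicator {q} (t \<omega>))"
    "expectation (\<lambda>\<omega>. g q \<omega> * indicator {q} (t \<omega>)) =
      prob (t -` {q} \<inter> space M) * expectation (g q)" if q: "q \<in> Q" for q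
  proof -
    let ?I = "\<lambda>\<omega>. indicator {q} (t \<omega>) :: real"
    have "?I \<in> borel_measurable ?H"
      by (rule measurable_compose[OF tH]) simp
    then have iv: "indep_var borel (g q) borel ?I"
      by (rule indep_set_imp_indep_var[OF indep F H g[OF q]])
    have tq: "t -` {q} \<inter> space M \<in> events"
      using q by (intro measurable_sets[OF t]) simp
    have I_eq: "?I \<omega> = indicator (t -` {q} \<inter> space M) \<omega>" if "\<omega> \<in> space M" for \<omega>
      using that by (simp add: indicator_def)
    have I: "integrable M ?I" "expectation ?I = prob (t -` {q} \<inter> space M)"
      using tq by (simp_all add: I_eq emeasure_eq_measure
        cong: Bochner_Integration.integrable_cong Bochner_Integration.integral_cong)
    show "integrable M (\<lambda>\<omega>. g q \<omega> * indicator {q} (t \<omega>))"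
      "expectation (\<lambda>\<omega>. g q \<omega> * indicator {q} (t \<omega>)) =
      prob (t -` {q} \<inter> space M) * expectation (g q)"
      using indep_var_integrable[OF iv int[OF q] I(1)]
        indep_var_lebesgue_integral[OF iv int[OF q] I(1)] I(2)
      by (simp_all add: mult.commute)
  qed
  show "expectation (\<lambda>\<omega>. g (t \<omega>) \<omega>) =
      (\<Sum>q\<in>Q. prob (t -` {q} \<inter> space M) * expectation (g q))"
    using prod by (simp add: split cong: Bochner_Integration.integral_cong)
qed

end

section \<open>Auxiliary facts on permutations, vectors and laws\<close>

lemma permutes_conj_involution:
  assumes \<pi>: "\<And>x. \<pi> (\<pi> x) = x" and q: "q permutes K"
  shows "\<pi> \<circ> q \<circ> \<pi> permutes \<pi> ` K"
proof -
  have "bij \<pi>" using \<pi> by (intro involuntory_imp_bij) 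
  then have "bij (\<pi> \<circ> q \<circ> \<pi>)"
    using permutes_bij[OF q] by (intro bij_comp)
  moreover have "(\<pi> \<circ> q \<circ> \<pi>) x = x" if "x \<notin> \<pi> ` K" for x
  proof -
    have "\<pi> x \<notin> K" using that \<pi> by (metis imageI)
    then show ?thesis using permutes_not_in[OF q] \<pi> by simp
  qed
  ultimately show ?thesis unfolding permutes_def bij_iff by blast
qed

lemma random_vector_measurable:
  assumes "\<And>j. j \<in> J \<Longrightarrow> v j \<in> borel_measurable M"
  shows "random_vector J v \<in> measurable M (Pi\<^sub>M J (\<lambda>_. borel))"
  using assms unfolding random_vector_def by (rule measurable_restrict)

lemma reindex_measurable:
  assumes "\<And>k. k \<in> K \<Longrightarrow> r k \<in> J"
  shows "(\<lambda>x. \<lambda>k\<in>K. x (r k)) \<in> measurable (Pi\<^sub>M J (\<lambda>_. N)) (Pi\<^sub>M K (\<lambda>_. N))"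
  using assms by (intro measurable_restrict measurable_component_singleton)

lemma vimage_algebra_component_measurable:
  fixes f :: "'i \<Rightarrow> 'a \<Rightarrow> real"
  assumes "j \<in> J"
  shows "f j \<in> borel_measurable (vimage_algebra \<Omega> (\<lambda>\<omega>. \<lambda>j\<in>J. f j \<omega>) (Pi\<^sub>M J (\<lambda>_. borel)))"
    (is "_ \<in> borel_measurable ?V")
proof -
  have "(\<lambda>\<omega>. \<lambda>j\<in>J. f j \<omega>) \<in> measurable ?V (Pi\<^sub>M J (\<lambda>_. borel))"
    by (intro measurable_vimage_algebra1) (auto simp: space_PiM)
  from measurable_compose[OF this measurable_component_singleton[OF assms]] show ?thesis
    using assms by simp
qed

lemma (in prob_space) expectation_indicator_comp:
  assumes f: "f \<in> measurable M L" and B: "B \<in> sets L"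
  shows "expectation (\<lambda>\<omega>. indicator B (f \<omega>)) = measure (distr M L f) B"
proof -
  have "expectation (\<lambda>\<omega>. indicator B (f \<omega>)) = expectation (indicator (f -` B \<inter> space M))"
    by (intro Bochner_Integration.integral_cong) (auto simp: indicator_def)
  also have "\<dots> = prob (f -` B \<inter> space M)"
    using Bochner_Integration.integral_indicator[of M "f -` B \<inter> space M"] by (simp add: Int_assoc)
  finally show ?thesis by (simp add: measure_distr[OF f B])
qed

lemma (in prob_space) distr_eqI_indicator:
  assumes f: "f \<in> measurable M L" and f': "f' \<in> measurable M L"
    and eq: "\<And>B. B \<in> sets L \<Longrightarrow>
      expectation (\<lambda>\<omega>. indicator B (f \<omega>) :: real) = expectation (\<lambda>\<omega>. indicator B (f' \<omega>) :: real)"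
  shows "distr M L f = distr M L f'"
proof (rule measure_eqI)
  interpret D: prob_space "distr M L f" using f by (rule prob_space_distr)
  interpret D': prob_space "distr M L f'" using f' by (rule prob_space_distr)
  fix B assume "B \<in> sets (distr M L f)"
  then show "emeasure (distr M L f) B = emeasure (distr M L f') B"
    using eq[of B] f f'
    by (simp add: expectation_indicator_comp D.emeasure_eq_measure D'.emeasure_eq_measure)
qed simp

section \<open>Exchangeability and shuffles\<close>

context data_market
begin

abbreviation consumers :: "nat set" where
  "consumers \<equiv> {1..N}"

definition primitives :: "'a measure" where
  "primitives = join_info (vector_info M consumers w) (vector_info M consumers e)"

text \<open>The law of the shuffle is left open, so that the constant identity qualifies alongside
  the uniform shuffles.\<close>

definition independent_shuffle :: "nat set \<Rightarrow> ('a \<Rightarrow> nat \<Rightarrow> nat) \<Rightarrow> bool" where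
  "independent_shuffle K t \<longleftrightarrow> t \<in> measurable M (count_space {q. q permutes K}) \<and>
     indep_set (sets primitives) (sets (shuffle_info M K t))"

definition shuffled_info :: "nat set \<Rightarrow> ('a \<Rightarrow> nat \<Rightarrow> nat) \<Rightarrow> 'a measure" where
  "shuffled_info K t = vector_info M K (\<lambda>j \<omega>. signal (t \<omega> j) \<omega>)"

lemma random_vector_primitives_measurable:
  "random_vector consumers w \<in> measurable M (Pi\<^sub>M consumers (\<lambda>_. borel))"
  "random_vector consumers e \<in> measurable M (Pi\<^sub>M consumers (\<lambda>_. borel))"
  using w_moments e_moments by (auto intro!: random_vector_measurable borel_measurable_integrable)

lemma sets_primitives:
  "sets primitives = sets (vimage_algebra (space M)
     (\<lambda>\<omega>. (random_vector consumers w \<omega>, random_vector consumers e \<omega>))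
     (Pi\<^sub>M consumers (\<lambda>_. borel) \<Otimes>\<^sub>M Pi\<^sub>M consumers (\<lambda>_. borel)))"
  unfolding primitives_def vector_info_def
  using random_vector_primitives_measurable[THEN measurable_space]
  by (intro sets_join_info_vimage_algebra) auto

lemma subalgebra_primitives: "subalgebra M primitives"
proof -
  have "subalgebra M (vimage_algebra (space M)
     (\<lambda>\<omega>. (random_vector consumers w \<omega>, random_vector consumers e \<omega>))
     (Pi\<^sub>M consumers (\<lambda>_. borel) \<Otimes>\<^sub>M Pi\<^sub>M consumers (\<lambda>_. borel)))"
    using random_vector_primitives_measurable
    by (intro subalgebra_vimage_algebra measurable_Pair)
  then show ?thesis
    using sets_eq_imp_space_eq[OF sets_primitives] by (simp add: subalgebra_def sets_primitives)
qed

lemma vector_primitives_measurable: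
  "(\<lambda>\<omega>. (random_vector consumers w \<omega>, random_vector consumers e \<omega>)) \<in>
     measurable primitives (Pi\<^sub>M consumers (\<lambda>_. borel) \<Otimes>\<^sub>M Pi\<^sub>M consumers (\<lambda>_. borel))"
  unfolding measurable_cong_sets[OF sets_primitives refl]
  using random_vector_primitives_measurable[THEN measurable_space]
  by (intro measurable_vimage_algebra1) (auto simp: space_pair_measure)

lemma primitives_measurable:
  assumes "j \<in> consumers"
  shows "w j \<in> borel_measurable primitives" "e j \<in> borel_measurable primitives"
    "signal j \<in> borel_measurable primitives"
proof -
  have "(\<lambda>\<omega>. random_vector consumers w \<omega> j) \<in> borel_measurable primitives"
    "(\<lambda>\<omega>. random_vector consumers e \<omega> j) \<in> borel_measurable primitives"
    using measurable_compose[OF vector_primitives_measurable, of "\<lambda>z. fst z j" borel]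
      measurable_compose[OF vector_primitives_measurable, of "\<lambda>z. snd z j" borel] assms
    by (auto intro: measurable_compose[OF measurable_fst] measurable_compose[OF measurable_snd]
      measurable_component_singleton)
  then show [measurable]: "w j \<in> borel_measurable primitives" "e j \<in> borel_measurable primitives"
    using assms by (simp_all add: random_vector_def)
  show "signal j \<in> borel_measurable primitives"
    unfolding signal_def by measurable
qed

lemma signal_measurable:
  assumes "j \<in> consumers"
  shows "signal j \<in> borel_measurable M"
  using measurable_from_subalg[OF subalgebra_primitives primitives_measurable(3)[OF assms]] .

text \<open>Exchangeability is given for \<open>w\<close> and \<open>e\<close> separately.
  Independence makes the joint law a product, which is then invariant when the same \<open>p\<close>
  acts on both vectors; acting on both is what permutes the signals.\<close>

lemma distr_permuted_primitives:
  assumes p: "p permutes consumers"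
    and h: "h \<in> measurable (Pi\<^sub>M consumers (\<lambda>_. borel) \<Otimes>\<^sub>M Pi\<^sub>M consumers (\<lambda>_. borel)) L"
  shows "distr M L (\<lambda>\<omega>. h (random_vector consumers (\<lambda>j. w (p j)) \<omega>, random_vector consumers (\<lambda>j. e (p j)) \<omega>)) =
    distr M L (\<lambda>\<omega>. h (random_vector consumers w \<omega>, random_vector consumers e \<omega>))"
proof -
  let ?P = "Pi\<^sub>M consumers (\<lambda>_. borel :: real measure)"
  let ?R = "\<lambda>x. \<lambda>j\<in>consumers. x (p j)"
  note rw = random_vector_primitives_measurable
  have R: "?R \<in> measurable ?P ?P"
    using permutes_in_image[OF p] by (intro reindex_measurable) simp
  have perm: "random_vector consumers (\<lambda>j. v (p j)) = ?R \<circ> random_vector consumers v"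
    for v :: "nat \<Rightarrow> 'a \<Rightarrow> real"
    using permutes_in_image[OF p] by (auto simp: random_vector_def fun_eq_iff)
  have Rw: "random_vector consumers (\<lambda>j. w (p j)) \<in> measurable M ?P"
    and Re: "random_vector consumers (\<lambda>j. e (p j)) \<in> measurable M ?P"
    unfolding perm using rw R by (auto intro: measurable_comp)
  have "indep_var ?P (random_vector consumers (\<lambda>j. w (p j))) ?P (random_vector consumers (\<lambda>j. e (p j)))"
    unfolding perm by (rule indep_var_compose[OF w_e_indep R R])
  then have "distr M (?P \<Otimes>\<^sub>M ?P)
      (\<lambda>\<omega>. (random_vector consumers (\<lambda>j. w (p j)) \<omega>, random_vector consumers (\<lambda>j. e (p j)) \<omega>)) =
    distr M ?P (random_vector consumers (\<lambda>j. w (p j))) \<Otimes>\<^sub>M distr M ?P (random_vector consumers (\<lambda>j. e (p j)))"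
    by (simp add: indep_var_distribution_eq)
  also have "\<dots> = distr M ?P (random_vector consumers w) \<Otimes>\<^sub>M distr M ?P (random_vector consumers e)"
    using w_exchangeable e_exchangeable p by (simp add: exchangeable_def)
  also have "\<dots> = distr M (?P \<Otimes>\<^sub>M ?P) (\<lambda>\<omega>. (random_vector consumers w \<omega>, random_vector consumers e \<omega>))"
    using w_e_indep by (simp add: indep_var_distribution_eq)
  finally have "distr (distr M (?P \<Otimes>\<^sub>M ?P)
      (\<lambda>\<omega>. (random_vector consumers (\<lambda>j. w (p j)) \<omega>, random_vector consumers (\<lambda>j. e (p j)) \<omega>))) L h =
    distr (distr M (?P \<Otimes>\<^sub>M ?P) (\<lambda>\<omega>. (random_vector consumers w \<omega>, random_vector consumers e \<omega>))) L h"
    by simp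
  then show ?thesis
    by (subst (asm) (1 2) distr_distr) (use h rw Rw Re in \<open>auto simp: comp_def\<close>)
qed

text \<open>The relabelling \<open>p\<close> moves the target and the signals together. The index
  map \<open>r\<close> leaves room for shuffled lists and for lists that omit a consumer.\<close>

lemma distr_signals_permuted:
  assumes p: "p permutes consumers" and i: "i \<in> consumers"
    and r: "\<And>k. k \<in> K \<Longrightarrow> r k \<in> consumers"
  shows "distr M (borel \<Otimes>\<^sub>M Pi\<^sub>M K (\<lambda>_. borel)) (\<lambda>\<omega>. (w (p i) \<omega>, \<lambda>k\<in>K. signal (p (r k)) \<omega>)) =
    distr M (borel \<Otimes>\<^sub>M Pi\<^sub>M K (\<lambda>_. borel)) (\<lambda>\<omega>. (w i \<omega>, \<lambda>k\<in>K. signal (r k) \<omega>))"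
proof -
  let ?P = "Pi\<^sub>M consumers (\<lambda>_. borel :: real measure)"
  define h where "h z = (fst z i, \<lambda>k\<in>K. fst z (r k) + \<sigma> * snd z (r k))"
    for z :: "(nat \<Rightarrow> real) \<times> (nat \<Rightarrow> real)"
  have comp: "(\<lambda>z. fst z j) \<in> borel_measurable (?P \<Otimes>\<^sub>M ?P)"
    "(\<lambda>z. snd z j) \<in> borel_measurable (?P \<Otimes>\<^sub>M ?P)" if "j \<in> consumers" for j
    using measurable_component_singleton[OF that, of "\<lambda>_. borel"]
    by (auto intro: measurable_compose[OF measurable_fst] measurable_compose[OF measurable_snd])
  have "h \<in> measurable (?P \<Otimes>\<^sub>M ?P) (borel \<Otimes>\<^sub>M Pi\<^sub>M K (\<lambda>_. borel))"
    unfolding h_def using comp[OF i] comp[OF r]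
    by (intro measurable_Pair measurable_restrict borel_measurable_add borel_measurable_times) auto
  from distr_permuted_primitives[OF p this] show ?thesis
    using i r by (simp add: h_def random_vector_def signal_def cong: restrict_cong)
qed

lemma signals_vector_measurable:
  assumes "\<And>k. k \<in> K \<Longrightarrow> r k \<in> consumers"
  shows "(\<lambda>\<omega>. \<lambda>k\<in>K. signal (r k) \<omega>) \<in> measurable primitives (Pi\<^sub>M K (\<lambda>_. borel))"
    and "(\<lambda>\<omega>. \<lambda>k\<in>K. signal (r k) \<omega>) \<in> measurable M (Pi\<^sub>M K (\<lambda>_. borel))"
  using assms primitives_measurable(3) signal_measurable by (auto intro!: measurable_restrict)

lemma shuffled_signal_measurable:
  assumes "t \<in> measurable M (count_space {q. q permutes K})" "K \<subseteq> consumers" "j \<in> consumers"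
  shows "(\<lambda>\<omega>. signal (t \<omega> j) \<omega>) \<in> borel_measurable M"
proof (rule measurable_compose_countable'[where f = "\<lambda>q. signal (q j)" and I = "{q. q permutes K}"])
  show "signal (q j) \<in> borel_measurable M" if "q \<in> {q. q permutes K}" for q
  proof -
    have "q permutes consumers" using that assms(2) permutes_subset by blast
    then show ?thesis using assms(3) permutes_in_image signal_measurable by metis
  qed
  show "countable {q. q permutes K}"
    using assms(2) finite_subset by (intro countable_finite finite_permutations) auto
qed (use assms in auto)

lemma shuffled_vector_measurable:
  assumes "t \<in> measurable M (count_space {q. q permutes K})" "K \<subseteq> consumers"
    "\<And>k. k \<in> K' \<Longrightarrow> r k \<in> consumers"
  shows "(\<lambda>\<omega>. \<lambda>k\<in>K'. signal (t \<omega> (r k)) \<omega>) \<in> measurable M (Pi\<^sub>M K' (\<lambda>_. borel))"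
  using assms by (intro measurable_restrict shuffled_signal_measurable)

lemma w_integrable:
  assumes "i \<in> consumers"
  shows "integrable M (w i)" "integrable M (\<lambda>\<omega>. (w i \<omega>)\<^sup>2)" "expectation (w i) = \<mu>"
  using w_moments[OF assms] by simp_all

lemma expectation_shuffle:
  fixes g :: "(nat \<Rightarrow> nat) \<Rightarrow> 'a \<Rightarrow> real"
  assumes t: "independent_shuffle K t" and K: "finite K"
    and g: "\<And>q. q permutes K \<Longrightarrow> g q \<in> borel_measurable primitives"
    and int: "\<And>q. q permutes K \<Longrightarrow> integrable M (g q)"
  shows "expectation (\<lambda>\<omega>. g (t \<omega>) \<omega>) =
      (\<Sum>q | q permutes K. prob (t -` {q} \<inter> space M) * expectation (g q))"
  using expectation_indep_finite[OF subalgebra_primitives _ finite_permutations[OF K], of t g]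
    assms by (auto simp: independent_shuffle_def shuffle_info_def)

lemma gain_shuffled_info_eq:
  assumes p: "p permutes consumers" "\<And>x. p (p x) = x" and i: "i \<in> consumers"
    and K: "K \<subseteq> consumers" and t: "independent_shuffle K t" and t': "independent_shuffle (p ` K) t'"
    and law: "\<And>q. q permutes K \<Longrightarrow>
      prob (t -` {q} \<inter> space M) = prob (t' -` {p \<circ> q \<circ> p} \<inter> space M)"
  shows "gain i (shuffled_info K t) = gain (p i) (shuffled_info (p ` K) t')"
proof -
  let ?L = "(borel :: real measure) \<Otimes>\<^sub>M Pi\<^sub>M K (\<lambda>_. borel :: real measure)"
  have pc: "p j \<in> consumers" if "j \<in> consumers" for j
    using permutes_in_image[OF p(1)] that by blast
  have pK: "p ` K \<subseteq> consumers" using K pc by blast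
  have finK: "finite K" using K finite_subset by blast
  have tm: "t \<in> measurable M (count_space {q. q permutes K})"
    and tm': "t' \<in> measurable M (count_space {q. q permutes p ` K})"
    using t t' by (auto simp: independent_shuffle_def)
  \<comment> \<open>The second list is re-indexed by \<open>K\<close>, so that both vectors live in
    one product space and their laws can be compared. The re-indexing is undone at the end, since it
    does not change the information.\<close>
  let ?Y = "\<lambda>\<omega>. \<lambda>k\<in>K. signal (t \<omega> k) \<omega>" and ?Y' = "\<lambda>\<omega>. \<lambda>k\<in>K. signal (t' \<omega> (p k)) \<omega>"
  have Y: "?Y \<in> measurable M (Pi\<^sub>M K (\<lambda>_. borel))" and Y': "?Y' \<in> measurable M (Pi\<^sub>M K (\<lambda>_. borel))"
    using K pc by (auto intro!: shuffled_vector_measurable[OF tm K] shuffled_vector_measurable[OF tm' pK])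
  note wM = borel_measurable_integrable[OF w_integrable(1)]
  have eq: "distr M ?L (\<lambda>\<omega>. (w i \<omega>, ?Y \<omega>)) = distr M ?L (\<lambda>\<omega>. (w (p i) \<omega>, ?Y' \<omega>))"
  proof (rule distr_eqI_indicator)
    fix B assume B[measurable]: "B \<in> sets ?L"
    let ?g = "\<lambda>q \<omega>. indicator B (w i \<omega>, \<lambda>k\<in>K. signal (q k) \<omega>) :: real"
    let ?g' = "\<lambda>q \<omega>. indicator B (w (p i) \<omega>, \<lambda>k\<in>K. signal (q (p k)) \<omega>) :: real"
    have q_in: "q j \<in> consumers" if "q permutes C" "C \<subseteq> consumers" "j \<in> consumers" for q C j
      using permutes_in_image[OF permutes_subset[OF that(1,2)]] that(3) by blast
    have gP: "?g q \<in> borel_measurable primitives" if "q permutes K" for q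
      using K q_in[OF that K] primitives_measurable(1)[OF i]
      by (intro measurable_compose[OF _ borel_measurable_indicator[OF B]] measurable_Pair
        signals_vector_measurable(1)) auto
    have gP': "?g' q \<in> borel_measurable primitives" if "q permutes p ` K" for q
      using K pc q_in[OF that pK] primitives_measurable(1)[OF pc[OF i]]
      by (intro measurable_compose[OF _ borel_measurable_indicator[OF B]] measurable_Pair
        signals_vector_measurable(1)) auto
    have int: "integrable M (\<lambda>\<omega>. indicator B (f \<omega>) :: real)"
      if "(\<lambda>\<omega>. indicator B (f \<omega>) :: real) \<in> borel_measurable primitives" for f :: "'a \<Rightarrow> real \<times> (nat \<Rightarrow> real)"
      using measurable_from_subalg[OF subalgebra_primitives that]
      by (intro integrable_const_bound[where B = 1]) (auto simp: indicator_def)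
    have gg': "expectation (?g q) = expectation (?g' (p \<circ> q \<circ> p))" if q: "q permutes K" for q
    proof -
      have m: "(\<lambda>\<omega>. (w i \<omega>, \<lambda>k\<in>K. signal (q k) \<omega>)) \<in> measurable M ?L"
        "(\<lambda>\<omega>. (w (p i) \<omega>, \<lambda>k\<in>K. signal (p (q k)) \<omega>)) \<in> measurable M ?L"
        using K pc q_in[OF q K] wM[OF i] wM[OF pc[OF i]]
        by (auto intro!: measurable_Pair signals_vector_measurable(2))
      have law_q: "distr M ?L (\<lambda>\<omega>. (w (p i) \<omega>, \<lambda>k\<in>K. signal (p (q k)) \<omega>)) =
        distr M ?L (\<lambda>\<omega>. (w i \<omega>, \<lambda>k\<in>K. signal (q k) \<omega>))"
        using K q_in[OF q K] by (intro distr_signals_permuted[OF p(1) i]) blast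
      have "expectation (?g q) = expectation (\<lambda>\<omega>. indicator B (w (p i) \<omega>, \<lambda>k\<in>K. signal (p (q k)) \<omega>))"
        using m B by (simp only: expectation_indicator_comp law_q)
      \<comment> \<open>The conjugate shuffle read at position \<open>p k\<close> gives
        \<open>p (q (p (p k)))\<close>, which is \<open>p (q k)\<close>.\<close>
      then show ?thesis by (simp add: p(2))
    qed
    have "expectation (\<lambda>\<omega>. ?g (t \<omega>) \<omega>) =
        (\<Sum>q | q permutes K. prob (t -` {q} \<inter> space M) * expectation (?g q))"
      by (rule expectation_shuffle[OF t finK, of ?g, OF gP int[OF gP]])
    also have "\<dots> = (\<Sum>q | q permutes p ` K. prob (t' -` {q} \<inter> space M) * expectation (?g' q))"
    proof (rule sum.reindex_bij_witness[where i = "\<lambda>q. p \<circ> q \<circ> p" and j = "\<lambda>q. p \<circ> q \<circ> p"])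
      show "p \<circ> q \<circ> p \<in> {q. q permutes p ` K}" if "q \<in> {q. q permutes K}" for q
        using that permutes_conj_involution[OF p(2)] by simp
      show "p \<circ> q \<circ> p \<in> {q. q permutes K}" if "q \<in> {q. q permutes p ` K}" for q
        using that permutes_conj_involution[OF p(2), of q "p ` K"] by (simp add: image_comp comp_def p(2))
      show "prob (t' -` {p \<circ> q \<circ> p} \<inter> space M) * expectation (?g' (p \<circ> q \<circ> p)) =
        prob (t -` {q} \<inter> space M) * expectation (?g q)" if "q \<in> {q. q permutes K}" for q
        using that law[of q] gg'[of q] by simp
    qed (auto simp: fun_eq_iff p(2))
    also have "\<dots> = expectation (\<lambda>\<omega>. ?g' (t' \<omega>) \<omega>)"
      by (rule expectation_shuffle[OF t' finite_imageI[OF finK], of ?g', OF gP' int[OF gP'], symmetric])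
    finally show "expectation (\<lambda>\<omega>. indicator B (w i \<omega>, ?Y \<omega>) :: real) =
      expectation (\<lambda>\<omega>. indicator B (w (p i) \<omega>, ?Y' \<omega>))" .
  qed (use Y Y' wM[OF i] wM[OF pc[OF i]] in auto)
  have sets_eq: "sets (vimage_algebra (space M) ?Y' (Pi\<^sub>M K (\<lambda>_. borel))) = sets (shuffled_info (p ` K) t')"
    unfolding shuffled_info_def vector_info_def random_vector_def
  proof (rule sets_vimage_algebra_eqI)
    let ?S = "\<lambda>k \<omega>. signal (t' \<omega> k) \<omega>"
    show "?Y' \<in> measurable (vimage_algebra (space M) (\<lambda>\<omega>. \<lambda>j\<in>p ` K. ?S j \<omega>) (Pi\<^sub>M (p ` K) (\<lambda>_. borel)))
        (Pi\<^sub>M K (\<lambda>_. borel))"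
      by (intro measurable_restrict vimage_algebra_component_measurable[where f = ?S] imageI)
    have "?S j \<in> borel_measurable (vimage_algebra (space M) ?Y' (Pi\<^sub>M K (\<lambda>_. borel)))" if "j \<in> p ` K" for j
      using vimage_algebra_component_measurable[where f = "\<lambda>k. ?S (p k)" and j = "p j" and J = K] that
      by (auto simp: p(2))
    then show "(\<lambda>\<omega>. \<lambda>j\<in>p ` K. ?S j \<omega>) \<in> measurable (vimage_algebra (space M) ?Y' (Pi\<^sub>M K (\<lambda>_. borel)))
        (Pi\<^sub>M (p ` K) (\<lambda>_. borel))"
      by (rule measurable_restrict)
  qed
  have "gain i (shuffled_info K t) = variance (real_cond_exp M (vimage_algebra (space M) ?Y (Pi\<^sub>M K (\<lambda>_. borel))) (w i))"
    by (simp add: gain_def shuffled_info_def vector_info_def random_vector_def)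
  also have "\<dots> = variance (real_cond_exp M (vimage_algebra (space M) ?Y' (Pi\<^sub>M K (\<lambda>_. borel))) (w (p i)))"
    by (rule variance_real_cond_exp_law[OF w_integrable(1)[OF i] w_integrable(1)[OF pc[OF i]] Y Y' eq])
  also have "\<dots> = gain (p i) (shuffled_info (p ` K) t')"
    by (simp add: gain_def real_cond_exp_cong_sets[OF sets_eq])
  finally show ?thesis .
qed

section \<open>Payoffs in terms of gains\<close>

lemma expectation_posterior:
  assumes F: "subalgebra M F" and i: "i \<in> consumers"
  shows "integrable M (real_cond_exp M F (w i))"
    and "integrable M (\<lambda>\<omega>. (real_cond_exp M F (w i) \<omega>)\<^sup>2)"
    and "expectation (real_cond_exp M F (w i)) = \<mu>"
    and "expectation (\<lambda>\<omega>. (real_cond_exp M F (w i) \<omega>)\<^sup>2) = gain i F + \<mu>\<^sup>2"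
proof -
  interpret F: finite_measure_subalgebra M F by unfold_locales fact
  show a: "integrable M (real_cond_exp M F (w i))" "expectation (real_cond_exp M F (w i)) = \<mu>"
    using F.real_cond_exp_int[OF w_integrable(1)[OF i]] w_integrable(3)[OF i] by simp_all
  show b: "integrable M (\<lambda>\<omega>. (real_cond_exp M F (w i) \<omega>)\<^sup>2)"
    by (rule integrable_real_cond_exp_power2[OF F w_integrable(1,2)[OF i]])
  show "expectation (\<lambda>\<omega>. (real_cond_exp M F (w i) \<omega>)\<^sup>2) = gain i F + \<mu>\<^sup>2"
    using variance_eq[OF a(1) b] by (simp add: gain_def a(2))
qed

text \<open>The finer information of the consumer drops out: by nesting, the product of the two
  posteriors has the same mean as the square of the coarser one. The cross term contributes 1/2 of
  the gain and the squared price term takes away 1/4.\<close>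

lemma producer_profit_eq:
  assumes F: "subalgebra M F" and Y: "subalgebra F Y" and i: "i \<in> consumers"
  shows "producer_profit i F Y = (gain i Y + (\<mu> - c)\<^sup>2) / 4"
proof -
  have MY: "subalgebra M Y" using F Y by (auto simp: subalgebra_def)
  let ?a = "real_cond_exp M Y (w i)" and ?b = "real_cond_exp M F (w i)"
  note [simp] = expectation_posterior[OF F i] expectation_posterior[OF MY i]
    expectation_real_cond_exp_nested[OF F Y w_integrable(1,2)[OF i]]
  have "producer_profit i F Y =
      expectation (\<lambda>\<omega>. ?a \<omega> * ?b \<omega> / 2 - c * ?b \<omega> / 2 - (?a \<omega>)\<^sup>2 / 4 + c\<^sup>2 / 4)"
    unfolding producer_profit_def price_def demand_def
    by (intro Bochner_Integration.integral_cong) (auto simp: field_simps power2_eq_square)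
  also have "\<dots> = (gain i Y + \<mu>\<^sup>2) / 2 - c * \<mu> / 2 - (gain i Y + \<mu>\<^sup>2) / 4 + c\<^sup>2 / 4"
    by (simp add: prob_space)
  also have "\<dots> = (gain i Y + (\<mu> - c)\<^sup>2) / 4"
    by (simp add: field_simps power2_eq_square)
  finally show ?thesis .
qed

text \<open>With demand q = b - p, where b is the consumer's posterior, -p q - q^2/2 = (p^2 -
  b^2)/2, so no product of two posteriors remains. The coefficient of \<open>gain i F\<close> is 1 -
  1/2. That of \<open>gain i Y\<close> is -1/2 + 1/8: the price multiplies willingness to pay, and
  p^2/2 gives back 1/8.\<close>

lemma consumer_surplus_eq:
  assumes F: "subalgebra M F" and Y: "subalgebra F Y" and i: "i \<in> consumers"
  shows "consumer_surplus i F Y = gain i F / 2 - 3 / 8 * gain i Y + (\<mu> - c)\<^sup>2 / 8"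
proof -
  have MY: "subalgebra M Y" using F Y by (auto simp: subalgebra_def)
  let ?a = "real_cond_exp M Y (w i)" and ?b = "real_cond_exp M F (w i)"
  note wi = w_integrable[OF i]
  have mult: "integrable M (\<lambda>\<omega>. real_cond_exp M G (w i) \<omega> * w i \<omega>)"
    "expectation (\<lambda>\<omega>. real_cond_exp M G (w i) \<omega> * w i \<omega>) = gain i G + \<mu>\<^sup>2" if G: "subalgebra M G" for G
    using expectation_mult_real_cond_exp[OF G wi(1,2) _ expectation_posterior(2)[OF G i]]
      expectation_posterior(4)[OF G i] by (simp_all add: power2_eq_square)
  note [simp] = expectation_posterior[OF F i] expectation_posterior[OF MY i]
    mult[OF F] mult[OF MY] wi
  have "consumer_surplus i F Y = expectation (\<lambda>\<omega>. ?b \<omega> * w i \<omega> - ?a \<omega> * w i \<omega> / 2 - c * w i \<omega> / 2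
      + (?a \<omega>)\<^sup>2 / 8 + c * ?a \<omega> / 4 + c\<^sup>2 / 8 - (?b \<omega>)\<^sup>2 / 2)"
    unfolding consumer_surplus_def price_def demand_def
    by (intro Bochner_Integration.integral_cong) (auto simp: field_simps power2_eq_square)
  also have "\<dots> = (gain i F + \<mu>\<^sup>2) - (gain i Y + \<mu>\<^sup>2) / 2 - c * \<mu> / 2
      + (gain i Y + \<mu>\<^sup>2) / 8 + c * \<mu> / 4 + c\<^sup>2 / 8 - (gain i F + \<mu>\<^sup>2) / 2"
    by (simp add: prob_space)
  also have "\<dots> = gain i F / 2 - 3 / 8 * gain i Y + (\<mu> - c)\<^sup>2 / 8"
    by (simp add: field_simps power2_eq_square)
  finally show ?thesis .
qed

lemma subalgebra_no_info:
  assumes "space F = space M"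
  shows "subalgebra F (no_info M)"
  using assms sets.top[of F] by (auto simp: subalgebra_def no_info_def sigma_sets_empty_eq)

lemma gain_no_info:
  assumes i: "i \<in> consumers"
  shows "gain i (no_info M) = 0"
proof -
  have sub: "subalgebra M (no_info M)" by (rule subalgebra_no_info) simp
  interpret F: finite_measure_subalgebra M "no_info M" by unfold_locales fact
  have "AE \<omega> in M. real_cond_exp M (no_info M) (w i) \<omega> = \<mu>"
  proof (rule F.real_cond_exp_charact)
    fix A assume "A \<in> sets (no_info M)"
    then have "A = {} \<or> A = space M" by (simp add: no_info_def sigma_sets_empty_eq)
    then show "(LINT \<omega>:A|M. w i \<omega>) = (LINT \<omega>:A|M. \<mu>)"
      using w_integrable[OF i]
      by (elim disjE) (simp_all add: set_integral_space prob_space, simp add: set_lebesgue_integral_def)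
  qed (use w_integrable[OF i] in simp_all)
  then have "gain i (no_info M) = variance (\<lambda>_. \<mu>)"
    unfolding gain_def by (intro variance_cong_AE) auto
  then show ?thesis by (simp add: prob_space)
qed

section \<open>The symmetric posterior\<close>

text \<open>Exchangeability makes a representing function \<open>\<psi>\<close> invariant only
  almost everywhere, separately for each permutation fixing \<open>i\<close>. Averaging
  \<open>\<psi>\<close> over this finite group makes the symmetry exact at every point, and the
  finitely many exceptional null sets keep the average a version of the posterior.\<close>

lemma symmetric_posterior:
  assumes i: "i \<in> consumers"
  obtains \<phi> where "\<phi> \<in> borel_measurable (Pi\<^sub>M consumers (\<lambda>_. borel))"
    and "AE \<omega> in M. real_cond_exp M (vector_info M consumers signal) (w i) \<omega> =
      \<phi> (random_vector consumers signal \<omega>)"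
    and "\<And>q x. q permutes consumers - {i} \<Longrightarrow> \<phi> (\<lambda>j\<in>consumers. x (q j)) = \<phi> x"
proof -
  let ?P = "Pi\<^sub>M consumers (\<lambda>_. borel :: real measure)"
  let ?S = "random_vector consumers signal"
  let ?Q = "{q. q permutes consumers - {i}}"
  define E where "E = real_cond_exp M (vector_info M consumers signal) (w i)"
  have S: "?S \<in> measurable M ?P"
    by (intro random_vector_measurable signal_measurable)
  obtain \<psi> where \<psi>: "\<psi> \<in> borel_measurable ?P"
    and E\<psi>: "\<And>\<omega>. \<omega> \<in> space M \<Longrightarrow> E \<omega> = \<psi> (?S \<omega>)"
    using real_cond_exp_factor[OF S, of "w i"] unfolding E_def vector_info_def by blast
  define \<phi> where "\<phi> x = (\<Sum>q\<in>?Q. \<psi> (\<lambda>j\<in>consumers. x (q j))) / real (card ?Q)" for x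
  have finQ: "finite ?Q" by (intro finite_permutations) simp
  have "card ?Q = fact (card (consumers - {i}))" by (intro card_permutations) simp_all
  then have cardQ: "real (card ?Q) \<noteq> 0" by simp
  have q_in: "q j \<in> consumers" if "q permutes consumers - {i}" "j \<in> consumers" for q j
    using permutes_in_image[OF permutes_subset[OF that(1)]] that(2) by blast
  \<comment> \<open>The permuted signals have the same joint law with \<open>w i\<close>, because
    \<open>q\<close> fixes \<open>i\<close>, so \<open>\<psi>\<close> also represents the posterior
    given them. They also carry the same information, so that posterior is \<open>E\<close>
    again.\<close>
  have ae: "AE \<omega> in M. E \<omega> = \<psi> (\<lambda>j\<in>consumers. ?S \<omega> (q j))" if q: "q \<in> ?Q" for q
  proof -
    have qc: "q permutes consumers" using q permutes_subset by blast
    have qi: "q i = i" using q permutes_not_in[of q "consumers - {i}" i] by simp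
    let ?Sq = "\<lambda>\<omega>. \<lambda>j\<in>consumers. signal (q j) \<omega>"
    have Sq: "?Sq \<in> measurable M ?P"
      using q_in q by (intro signals_vector_measurable(2)) blast
    have law: "distr M (borel \<Otimes>\<^sub>M ?P) (\<lambda>\<omega>. (w i \<omega>, ?S \<omega>)) = distr M (borel \<Otimes>\<^sub>M ?P) (\<lambda>\<omega>. (w i \<omega>, ?Sq \<omega>))"
      using distr_signals_permuted[OF qc i, of consumers "\<lambda>k. k"]
      by (simp add: qi random_vector_def)
    have sets_eq: "sets (vimage_algebra (space M) ?Sq ?P) = sets (vector_info M consumers signal)"
      unfolding vector_info_def random_vector_def
    proof (rule sets_vimage_algebra_eqI)
      show "?Sq \<in> measurable (vimage_algebra (space M) (\<lambda>\<omega>. \<lambda>j\<in>consumers. signal j \<omega>) ?P) ?P"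
        using q_in q by (intro measurable_restrict vimage_algebra_component_measurable[where f = signal]) blast
      have "signal j \<in> borel_measurable (vimage_algebra (space M) ?Sq ?P)" if "j \<in> consumers" for j
        using vimage_algebra_component_measurable[where f = "\<lambda>j. signal (q j)" and j = "inv q j" and J = consumers]
          permutes_in_image[OF permutes_inv[OF qc]] that by (simp add: permutes_inverses[OF qc])
      then show "(\<lambda>\<omega>. \<lambda>j\<in>consumers. signal j \<omega>) \<in> measurable (vimage_algebra (space M) ?Sq ?P) ?P"
        by (rule measurable_restrict)
    qed
    have "AE \<omega> in M. real_cond_exp M (vimage_algebra (space M) ?Sq ?P) (w i) \<omega> = \<psi> (?Sq \<omega>)"
      (is "AE \<omega> in M. ?E \<omega> = _")
      using E\<psi> unfolding E_def vector_info_def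
      by (intro real_cond_exp_factor_law[OF w_integrable(1)[OF i] w_integrable(1)[OF i] S Sq law \<psi>]) auto
    moreover have "?Sq \<omega> = (\<lambda>j\<in>consumers. ?S \<omega> (q j))" for \<omega>
      unfolding random_vector_def using permutes_in_image[OF qc]
      by (intro restrict_ext) (simp del: atLeastAtMost_iff)
    moreover have "?E = E" unfolding E_def by (rule real_cond_exp_cong_sets[OF sets_eq])
    ultimately show ?thesis by (simp only:)
  qed
  show thesis
  proof (rule that[of \<phi>])
    have "(\<lambda>x. \<psi> (\<lambda>j\<in>consumers. x (q j))) \<in> borel_measurable ?P" if "q \<in> ?Q" for q
      using that q_in by (intro measurable_compose[OF reindex_measurable \<psi>]) blast
    then show "\<phi> \<in> borel_measurable ?P"
      unfolding \<phi>_def by (intro borel_measurable_divide borel_measurable_sum) auto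
    have "AE \<omega> in M. \<forall>q\<in>?Q. E \<omega> = \<psi> (\<lambda>j\<in>consumers. ?S \<omega> (q j))"
      using ae finQ by (intro AE_finite_allI)
    then show "AE \<omega> in M. real_cond_exp M (vector_info M consumers signal) (w i) \<omega> = \<phi> (?S \<omega>)"
    proof eventually_elim
      case (elim \<omega>)
      then have "(\<Sum>q\<in>?Q. \<psi> (\<lambda>j\<in>consumers. ?S \<omega> (q j))) = (\<Sum>q\<in>?Q. E \<omega>)"
        by (intro sum.cong) auto
      then show ?case using cardQ unfolding E_def[symmetric] by (simp add: \<phi>_def)
    qed
    show "\<phi> (\<lambda>j\<in>consumers. x (q j)) = \<phi> x" if q: "q permutes consumers - {i}" for q and x :: "nat \<Rightarrow> real"
    proof -
      have "(\<Sum>p\<in>?Q. \<psi> (\<lambda>j\<in>consumers. (\<lambda>j\<in>consumers. x (q j)) (p j))) =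
          (\<Sum>p\<in>?Q. \<psi> (\<lambda>j\<in>consumers. x ((q \<circ> p) j)))"
        using q_in by (intro sum.cong refl arg_cong[of _ _ \<psi>] restrict_ext) (simp del: atLeastAtMost_iff)
      \<comment> \<open>Composition with \<open>q\<close> on the left is a bijection of the group
        over which the average runs.\<close>
      also have "\<dots> = (\<Sum>p\<in>?Q. \<psi> (\<lambda>j\<in>consumers. x (p j)))"
        by (rule setum_permutations_compose_left[OF q, symmetric])
      finally show ?thesis by (simp add: \<phi>_def)
    qed
  qed
qed

section \<open>Posterior given the own signal and shuffled data\<close>

lemma shuffle_permutes:
  assumes "independent_shuffle K t" "\<omega> \<in> space M"
  shows "t \<omega> permutes K"
proof -
  have "t \<in> measurable M (count_space {q. q permutes K})"
    using assms(1) by (simp add: independent_shuffle_def)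
  from measurable_space[OF this assms(2)] show ?thesis by simp
qed

lemma shuffled_info_vimage:
  assumes "independent_shuffle K t" "K \<subseteq> consumers"
  shows "(\<lambda>\<omega>. \<lambda>k\<in>K. signal (t \<omega> k) \<omega>) \<in> measurable M (Pi\<^sub>M K (\<lambda>_. borel))"
    and "shuffled_info K t = vimage_algebra (space M) (\<lambda>\<omega>. \<lambda>k\<in>K. signal (t \<omega> k) \<omega>) (Pi\<^sub>M K (\<lambda>_. borel))"
proof -
  show "(\<lambda>\<omega>. \<lambda>k\<in>K. signal (t \<omega> k) \<omega>) \<in> measurable M (Pi\<^sub>M K (\<lambda>_. borel))"
    using assms by (intro shuffled_vector_measurable) (auto simp: independent_shuffle_def)
qed (simp add: shuffled_info_def vector_info_def random_vector_def)

lemma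
  assumes t: "independent_shuffle K t" and K: "K \<subseteq> consumers" and i: "i \<in> consumers"
  defines "V \<equiv> vimage_algebra (space M)
      (\<lambda>\<omega>. (signal i \<omega>, \<lambda>k\<in>K. signal (t \<omega> k) \<omega>)) (borel \<Otimes>\<^sub>M Pi\<^sub>M K (\<lambda>_. borel))"
  shows sets_own_join: "sets (join_info (own_info i) (shuffled_info K t)) = sets V"
    and subalgebra_own_join: "subalgebra M (join_info (own_info i) (shuffled_info K t))"
    and subalgebra_join: "subalgebra (join_info (own_info i) (shuffled_info K t)) (shuffled_info K t)"
    and signal_own_join_measurable: "signal i \<in> borel_measurable (join_info (own_info i) (shuffled_info K t))"
    and shuffled_own_join_measurable: "\<And>k. k \<in> K \<Longrightarrow>
      (\<lambda>\<omega>. signal (t \<omega> k) \<omega>) \<in> borel_measurable (join_info (own_info i) (shuffled_info K t))"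
proof -
  let ?Y = "\<lambda>\<omega>. \<lambda>k\<in>K. signal (t \<omega> k) \<omega>"
  have Y: "?Y \<in> measurable M (Pi\<^sub>M K (\<lambda>_. borel))"
    and info: "shuffled_info K t = vimage_algebra (space M) ?Y (Pi\<^sub>M K (\<lambda>_. borel))"
    using shuffled_info_vimage[OF t K] by simp_all
  show sets_eq: "sets (join_info (own_info i) (shuffled_info K t)) = sets V"
    unfolding V_def own_info_def info
    using measurable_space[OF Y] by (intro sets_join_info_vimage_algebra) auto
  have space_eq: "space (join_info (own_info i) (shuffled_info K t)) = space M"
    using sets_eq_imp_space_eq[OF sets_eq] by (simp add: V_def)
  have sY: "(\<lambda>\<omega>. (signal i \<omega>, ?Y \<omega>)) \<in> measurable M (borel \<Otimes>\<^sub>M Pi\<^sub>M K (\<lambda>_. borel))"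
    using signal_measurable[OF i] Y by (intro measurable_Pair)
  show "subalgebra M (join_info (own_info i) (shuffled_info K t))"
    using subalgebra_vimage_algebra[OF sY] sets_eq space_eq by (simp add: subalgebra_def V_def)
  have V: "(\<lambda>\<omega>. (signal i \<omega>, ?Y \<omega>)) \<in> measurable V (borel \<Otimes>\<^sub>M Pi\<^sub>M K (\<lambda>_. borel))"
    unfolding V_def using measurable_space[OF sY] by (intro measurable_vimage_algebra1) auto
  have YV: "?Y \<in> measurable V (Pi\<^sub>M K (\<lambda>_. borel))"
    using measurable_compose[OF V measurable_snd] by simp
  show "signal i \<in> borel_measurable (join_info (own_info i) (shuffled_info K t))"
    using measurable_compose[OF V measurable_fst] by (simp add: measurable_cong_sets[OF sets_eq refl])
  show "(\<lambda>\<omega>. signal (t \<omega> k) \<omega>) \<in> borel_measurable (join_info (own_info i) (shuffled_info K t))"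
    if "k \<in> K" for k
    using measurable_compose[OF YV measurable_component_singleton[OF that]] that
    by (simp add: measurable_cong_sets[OF sets_eq refl])
  have "sets (shuffled_info K t) \<subseteq> sets V"
    unfolding info by (intro sets_image_in_sets YV) (simp add: V_def)
  then show "subalgebra (join_info (own_info i) (shuffled_info K t)) (shuffled_info K t)"
    using sets_eq space_eq by (simp add: subalgebra_def info)
qed

text \<open>An event of the join depends on the signals and the shuffle. Conditioning on the value
  of the shuffle writes integrals over it as weighted sums of integrals against functions of S,
  where \<open>w i\<close> may be replaced by its posterior given S. Measurability of that posterior
  for the join, assumed in \<open>\<phi>F\<close>, then identifies it as the posterior given the
  join.\<close>

lemma real_cond_exp_own_join:
  assumes t: "independent_shuffle K t" and K: "K \<subseteq> consumers" and i: "i \<in> consumers"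
    and \<phi>: "\<phi> \<in> borel_measurable (Pi\<^sub>M consumers (\<lambda>_. borel))"
    and ae: "AE \<omega> in M. real_cond_exp M (vector_info M consumers signal) (w i) \<omega> =
      \<phi> (random_vector consumers signal \<omega>)"
    and \<phi>F: "(\<lambda>\<omega>. \<phi> (random_vector consumers signal \<omega>)) \<in>
      borel_measurable (join_info (own_info i) (shuffled_info K t))"
  shows "AE \<omega> in M. real_cond_exp M (join_info (own_info i) (shuffled_info K t)) (w i) \<omega> =
    \<phi> (random_vector consumers signal \<omega>)"
proof -
  let ?P = "Pi\<^sub>M consumers (\<lambda>_. borel :: real measure)"
  let ?L = "(borel :: real measure) \<Otimes>\<^sub>M Pi\<^sub>M K (\<lambda>_. borel :: real measure)"
  let ?F = "join_info (own_info i) (shuffled_info K t)"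
  let ?S = "random_vector consumers signal" and ?G = "vector_info M consumers signal"
  have S: "?S \<in> measurable primitives ?P" "?S \<in> measurable M ?P"
    using primitives_measurable(3) signal_measurable by (auto intro!: random_vector_measurable)
  have G: "subalgebra M ?G"
    unfolding vector_info_def by (rule subalgebra_vimage_algebra[OF S(2)])
  interpret F: finite_measure_subalgebra M ?F
    by unfold_locales (rule subalgebra_own_join[OF t K i])
  interpret G: finite_measure_subalgebra M ?G
    by unfold_locales (rule G)
  have finK: "finite K" using K finite_subset by blast
  define h where "h \<omega> = \<phi> (?S \<omega>)" for \<omega>
  have hP: "h \<in> borel_measurable primitives" and hM: "h \<in> borel_measurable M"
    unfolding h_def using measurable_compose[OF S(1) \<phi>] measurable_compose[OF S(2) \<phi>] by simp_all
  have aeh: "AE \<omega> in M. real_cond_exp M ?G (w i) \<omega> = h \<omega>"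
    using ae by (simp add: h_def)
  have h_int: "integrable M h"
    using G.real_cond_exp_int(1)[OF w_integrable(1)[OF i]] aeh hM
    by (subst integrable_cong_AE[where g = "real_cond_exp M ?G (w i)"]) auto
  have tm: "(\<lambda>\<omega>. (signal i \<omega>, \<lambda>k\<in>K. signal (t \<omega> k) \<omega>)) \<in> measurable M ?L"
    using signal_measurable[OF i] shuffled_info_vimage(1)[OF t K] by (intro measurable_Pair)
  show ?thesis
    unfolding h_def[symmetric]
  proof (rule F.real_cond_exp_charact[OF _ w_integrable(1)[OF i] h_int])
    show "h \<in> borel_measurable ?F" using \<phi>F by (simp add: h_def[abs_def])
    fix A assume "A \<in> sets ?F"
    then obtain B where B: "B \<in> sets ?L"
      and A: "A = (\<lambda>\<omega>. (signal i \<omega>, \<lambda>k\<in>K. signal (t \<omega> k) \<omega>)) -` B \<inter> space M"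
      unfolding sets_own_join[OF t K i] sets_vimage_algebra_measurable[OF tm] by blast
    let ?I = "\<lambda>q \<omega>. indicator B (signal i \<omega>, \<lambda>k\<in>K. signal (q k) \<omega>) :: real"
    \<comment> \<open>Stated for general \<open>f\<close> because it is applied both to
      \<open>w i\<close> and to its candidate posterior \<open>h\<close>.\<close>
    have split: "(LINT \<omega>:A|M. f \<omega>) =
        (\<Sum>q | q permutes K. prob (t -` {q} \<inter> space M) * expectation (\<lambda>\<omega>. ?I q \<omega> * f \<omega>))"
      if f: "f \<in> borel_measurable primitives" "integrable M f" for f
    proof -
      let ?g = "\<lambda>q \<omega>. ?I q \<omega> * f \<omega>"
      have qk: "q k \<in> consumers" if "q permutes K" "k \<in> K" for q k
        using permutes_in_image[OF that(1)] that(2) K by blast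
      have gP: "?g q \<in> borel_measurable primitives" if "q permutes K" for q
        using f(1) primitives_measurable(3)[OF i] signals_vector_measurable(1)[of K q, OF qk[OF that]]
        by (intro borel_measurable_times measurable_compose[OF _ borel_measurable_indicator[OF B]]
          measurable_Pair)
      have gint: "integrable M (?g q)" if "q permutes K" for q
        using f(2) measurable_from_subalg[OF subalgebra_primitives gP[OF that]]
        by (intro Bochner_Integration.integrable_bound[OF f(2)]) (auto simp: indicator_def)
      have "(LINT \<omega>:A|M. f \<omega>) = expectation (\<lambda>\<omega>. ?g (t \<omega>) \<omega>)"
        unfolding set_lebesgue_integral_def A
        by (intro Bochner_Integration.integral_cong) (auto simp: indicator_def)
      also have "\<dots> = (\<Sum>q | q permutes K. prob (t -` {q} \<inter> space M) * expectation (?g q))"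
        by (rule expectation_shuffle[OF t finK, of ?g, OF gP gint])
      finally show ?thesis .
    qed
    have IG: "expectation (\<lambda>\<omega>. ?I q \<omega> * w i \<omega>) = expectation (\<lambda>\<omega>. ?I q \<omega> * h \<omega>)"
      if q: "q permutes K" for q
    proof -
      have qk: "q k \<in> consumers" if "k \<in> K" for k
        using permutes_in_image[OF q] that K by blast
      have sG: "signal j \<in> borel_measurable ?G" if "j \<in> consumers" for j
        unfolding vector_info_def random_vector_def
        by (rule vimage_algebra_component_measurable[OF that])
      have I: "?I q \<in> borel_measurable ?G"
        using sG[OF i] sG[OF qk]
        by (intro measurable_compose[OF _ borel_measurable_indicator[OF B]] measurable_Pair measurable_restrict)
      have int: "integrable M (\<lambda>\<omega>. ?I q \<omega> * w i \<omega>)"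
        using w_integrable(1)[OF i] measurable_from_subalg[OF G I]
        by (intro Bochner_Integration.integrable_bound[OF w_integrable(1)[OF i]])
          (auto simp: indicator_def)
      have "expectation (\<lambda>\<omega>. ?I q \<omega> * w i \<omega>) = expectation (\<lambda>\<omega>. ?I q \<omega> * real_cond_exp M ?G (w i) \<omega>)"
        using G.real_cond_exp_intg(2)[OF int I] w_integrable(1)[OF i] by simp
      also have "\<dots> = expectation (\<lambda>\<omega>. ?I q \<omega> * h \<omega>)"
        using aeh measurable_from_subalg[OF G I] hM by (intro integral_cong_AE) auto
      finally show ?thesis .
    qed
    show "(LINT \<omega>:A|M. w i \<omega>) = (LINT \<omega>:A|M. h \<omega>)"
      using split[OF primitives_measurable(1)[OF i] w_integrable(1)[OF i]] split[OF hP h_int] IG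
      by simp
  qed
qed

text \<open>Knowing the own signal \<open>s\<^sub>i\<close>, one recovers the other signals up to order from the shuffled
  list of all signals: swap any entry equal to \<open>s\<^sub>i\<close> into position \<open>i\<close>. All such swaps give the
  same value of \<open>\<phi>\<close>, so averaging over them avoids a measurable selection.\<close>

lemma symmetric_function_measurable_all:
  fixes \<phi> :: "(nat \<Rightarrow> real) \<Rightarrow> real"
  assumes t: "independent_shuffle consumers t" and i: "i \<in> consumers"
    and \<phi>: "\<phi> \<in> borel_measurable (Pi\<^sub>M consumers (\<lambda>_. borel))"
    and sym: "\<And>q x. q permutes consumers - {i} \<Longrightarrow> \<phi> (\<lambda>j\<in>consumers. x (q j)) = \<phi> x"
  shows "(\<lambda>\<omega>. \<phi> (random_vector consumers signal \<omega>)) \<in>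
    borel_measurable (join_info (own_info i) (shuffled_info consumers t))" (is "_ \<in> borel_measurable ?F")
proof -
  have F: "subalgebra M ?F" by (rule subalgebra_own_join[OF t order_refl i])
  let ?y = "\<lambda>k \<omega>. signal (t \<omega> k) \<omega>"
  let ?m = "\<lambda>k \<omega>. if ?y k \<omega> = signal i \<omega> then 1 else 0 :: real"
  let ?z = "\<lambda>k \<omega>. \<phi> (\<lambda>j\<in>consumers. ?y (Transposition.transpose k i j) \<omega>)"
  have y: "?y k \<in> borel_measurable ?F" if "k \<in> consumers" for k
    by (rule shuffled_own_join_measurable[OF t order_refl i that])
  have m: "?m k \<in> borel_measurable ?F" if "k \<in> consumers" for k
  proof -
    note [measurable] = y[OF that] signal_own_join_measurable[OF t order_refl i]
    show ?thesis by measurable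
  qed
  have tr: "Transposition.transpose k i j \<in> consumers" if "k \<in> consumers" "j \<in> consumers" for j k
    using permutes_in_image[OF permutes_swap_id[OF that(1) i]] that(2) by blast
  have z: "?z k \<in> borel_measurable ?F" if "k \<in> consumers" for k
    using y tr[OF that] by (intro measurable_compose[OF measurable_restrict \<phi>]) blast
  have "\<phi> (random_vector consumers signal \<omega>) =
      (\<Sum>k\<in>consumers. ?m k \<omega> * ?z k \<omega>) / (\<Sum>k\<in>consumers. ?m k \<omega>)" if \<omega>: "\<omega> \<in> space ?F" for \<omega>
  proof -
    have t\<omega>: "t \<omega> permutes consumers"
      using F \<omega> by (intro shuffle_permutes[OF t]) (simp add: subalgebra_def)
    have z_eq: "?z k \<omega> = \<phi> (random_vector consumers signal \<omega>)"
      if k: "k \<in> consumers" and eq: "?y k \<omega> = signal i \<omega>" for k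
    proof -
      let ?p = "t \<omega> \<circ> Transposition.transpose k i"
      \<comment> \<open>Swapping positions \<open>k\<close> and \<open>i\<close> puts the label
        \<open>t \<omega> k\<close> at position \<open>i\<close>. If signals tie, this label need
        not be \<open>i\<close>; swapping the two labels repairs this without changing any value, as
        their signals agree. The corrected permutation fixes \<open>i\<close>, so the symmetry of
        \<open>\<phi>\<close> applies.\<close>
      let ?q = "Transposition.transpose (t \<omega> k) i \<circ> ?p"
      have p: "?p permutes consumers"
        by (rule permutes_compose[OF permutes_swap_id[OF k i] t\<omega>])
      have tk: "t \<omega> k \<in> consumers" using permutes_in_image[OF t\<omega>] k by blast
      have q: "?q permutes consumers"
        by (rule permutes_compose[OF p permutes_swap_id[OF tk i]])
      have "?q i = i" by simp
      then have q': "?q permutes consumers - {i}"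
        using permutes_superset[OF q, of "consumers - {i}"] by auto
      have sig: "signal (?q j) \<omega> = signal (?p j) \<omega>" for j
        using eq by (simp add: Transposition.transpose_def)
      have q_in: "?q j \<in> consumers" if "j \<in> consumers" for j
        using permutes_in_image[OF q] that by blast
      have "?z k \<omega> = \<phi> (\<lambda>j\<in>consumers. random_vector consumers signal \<omega> (?q j))"
        using q_in sig unfolding random_vector_def
        by (intro arg_cong[of _ _ \<phi>] restrict_ext) (simp del: atLeastAtMost_iff add: comp_def)
      then show ?thesis using sym[OF q', of "random_vector consumers signal \<omega>"] by (simp only:)
    qed
    \<comment> \<open>The position at which the shuffle lists consumer \<open>i\<close> always
      matches, so the average has a positive denominator.\<close>
    have "inv (t \<omega>) i \<in> consumers" using permutes_in_image[OF permutes_inv[OF t\<omega>]] i by blast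
    moreover have "?m (inv (t \<omega>) i) \<omega> = 1" by (simp add: permutes_inverses[OF t\<omega>])
    ultimately have "(\<Sum>k\<in>consumers. ?m k \<omega>) > 0"
      by (intro sum_pos2[where i = "inv (t \<omega>) i"]) auto
    moreover have "(\<Sum>k\<in>consumers. ?m k \<omega> * ?z k \<omega>) =
        (\<Sum>k\<in>consumers. ?m k \<omega>) * \<phi> (random_vector consumers signal \<omega>)"
      unfolding sum_distrib_right using z_eq by (intro sum.cong refl) simp
    ultimately show ?thesis by simp
  qed
  moreover have "(\<lambda>\<omega>. (\<Sum>k\<in>consumers. ?m k \<omega> * ?z k \<omega>) / (\<Sum>k\<in>consumers. ?m k \<omega>)) \<in> borel_measurable ?F"
    using m z by (intro borel_measurable_divide borel_measurable_sum borel_measurable_times)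
  ultimately show ?thesis
    by (subst measurable_cong)
qed

text \<open>Here no entry has to be located: the own signal goes to position \<open>i\<close> and
  the shuffled list fills the rest. The result is S rearranged by a permutation that fixes
  \<open>i\<close>.\<close>

lemma symmetric_function_measurable_others:
  fixes \<phi> :: "(nat \<Rightarrow> real) \<Rightarrow> real"
  assumes t: "independent_shuffle (consumers - {i}) t" and i: "i \<in> consumers"
    and \<phi>: "\<phi> \<in> borel_measurable (Pi\<^sub>M consumers (\<lambda>_. borel))"
    and sym: "\<And>q x. q permutes consumers - {i} \<Longrightarrow> \<phi> (\<lambda>j\<in>consumers. x (q j)) = \<phi> x"
  shows "(\<lambda>\<omega>. \<phi> (random_vector consumers signal \<omega>)) \<in>
    borel_measurable (join_info (own_info i) (shuffled_info (consumers - {i}) t))"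
    (is "_ \<in> borel_measurable ?F")
proof -
  have F: "subalgebra M ?F" by (rule subalgebra_own_join[OF t Diff_subset i])
  let ?y = "\<lambda>j \<omega>. if j = i then signal i \<omega> else signal (t \<omega> j) \<omega>"
  have "?y j \<in> borel_measurable ?F" if "j \<in> consumers" for j
    using shuffled_own_join_measurable[OF t Diff_subset i, of j]
      signal_own_join_measurable[OF t Diff_subset i] that by (cases "j = i") auto
  then have "(\<lambda>\<omega>. \<phi> (\<lambda>j\<in>consumers. ?y j \<omega>)) \<in> borel_measurable ?F"
    by (intro measurable_compose[OF measurable_restrict \<phi>])
  moreover have "\<phi> (random_vector consumers signal \<omega>) = \<phi> (\<lambda>j\<in>consumers. ?y j \<omega>)"
    if \<omega>: "\<omega> \<in> space ?F" for \<omega>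
  proof -
    have t\<omega>: "t \<omega> permutes consumers - {i}"
      using F \<omega> by (intro shuffle_permutes[OF t]) (simp add: subalgebra_def)
    have "t \<omega> j \<in> consumers" if "j \<in> consumers" for j
      using permutes_in_image[OF permutes_subset[OF t\<omega> Diff_subset]] that by blast
    then have "(\<lambda>j\<in>consumers. ?y j \<omega>) = (\<lambda>j\<in>consumers. random_vector consumers signal \<omega> (t \<omega> j))"
      using permutes_not_in[OF t\<omega>, of i] unfolding random_vector_def
      by (intro restrict_ext) (simp del: atLeastAtMost_iff)
    then show ?thesis using sym[OF t\<omega>, of "random_vector consumers signal \<omega>"] by (simp only:)
  qed
  ultimately show ?thesis
    by (subst measurable_cong)
qed

text \<open>Both posteriors agree almost everywhere with one function of S. Refusing to sell
  therefore leaves what the consumer herself learns unchanged; her payment reflects only what the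
  producer learns for pricing.\<close>

lemma gain_own_join_eq:
  assumes t: "independent_shuffle consumers t" and t': "independent_shuffle (consumers - {i}) t'"
    and i: "i \<in> consumers"
  shows "gain i (join_info (own_info i) (shuffled_info (consumers - {i}) t')) =
    gain i (join_info (own_info i) (shuffled_info consumers t))"
proof -
  obtain \<phi> where \<phi>: "\<phi> \<in> borel_measurable (Pi\<^sub>M consumers (\<lambda>_. borel))"
    "AE \<omega> in M. real_cond_exp M (vector_info M consumers signal) (w i) \<omega> =
      \<phi> (random_vector consumers signal \<omega>)"
    and sym: "\<And>q x. q permutes consumers - {i} \<Longrightarrow> \<phi> (\<lambda>j\<in>consumers. x (q j)) = \<phi> x"
    using symmetric_posterior[OF i] by blast
  have "(\<lambda>\<omega>. \<phi> (random_vector consumers signal \<omega>)) \<in>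
      borel_measurable (join_info (own_info i) (shuffled_info consumers t))"
    using sym by (rule symmetric_function_measurable_all[OF t i \<phi>(1)])
  from real_cond_exp_own_join[OF t order_refl i \<phi> this]
  have "AE \<omega> in M. real_cond_exp M (join_info (own_info i) (shuffled_info consumers t)) (w i) \<omega> =
      \<phi> (random_vector consumers signal \<omega>)" .
  moreover
  have "(\<lambda>\<omega>. \<phi> (random_vector consumers signal \<omega>)) \<in>
      borel_measurable (join_info (own_info i) (shuffled_info (consumers - {i}) t'))"
    using sym by (rule symmetric_function_measurable_others[OF t' i \<phi>(1)])
  from real_cond_exp_own_join[OF t' Diff_subset i \<phi> this]
  have "AE \<omega> in M.
      real_cond_exp M (join_info (own_info i) (shuffled_info (consumers - {i}) t')) (w i) \<omega> =
      \<phi> (random_vector consumers signal \<omega>)" .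
  ultimately have "AE \<omega> in M.
      real_cond_exp M (join_info (own_info i) (shuffled_info (consumers - {i}) t')) (w i) \<omega> =
      real_cond_exp M (join_info (own_info i) (shuffled_info consumers t)) (w i) \<omega>"
    by eventually_elim simp
  then show ?thesis
    unfolding gain_def by (intro variance_cong_AE) auto
qed

section \<open>Identity and uniform shuffles\<close>

lemma independent_shuffle_id: "independent_shuffle K (\<lambda>_. id)"
proof -
  have id: "(\<lambda>_. id) \<in> measurable M (count_space {q. q permutes K})"
    by (simp add: permutes_id)
  have "b = {} \<or> b = space M" if "b \<in> sets (shuffle_info M K (\<lambda>_. id))" for b
    using that unfolding shuffle_info_def sets_vimage_algebra_measurable[OF id] by (auto split: if_splits)
  moreover have "a \<inter> space M = a" "a \<in> events" if "a \<in> sets primitives" for a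
    using that subalgebra_primitives sets.sets_into_space[of a M] by (auto simp: subalgebra_def)
  ultimately have "indep_set (sets primitives) (sets (shuffle_info M K (\<lambda>_. id)))"
    unfolding indep_sets2_eq by (fastforce simp: prob_space)
  then show ?thesis using id by (simp add: independent_shuffle_def)
qed

lemma independent_shuffle_uniform:
  assumes "uniform_shuffle M K t"
    and "indep_set (sets (join_info (vector_info M consumers w) (vector_info M consumers e)))
      (sets (shuffle_info M K t))"
  shows "independent_shuffle K t"
  using assms by (simp add: independent_shuffle_def uniform_shuffle_def primitives_def)

lemma prob_uniform_shuffle:
  assumes t: "uniform_shuffle M K t" and K: "finite K" and q: "q permutes K"
  shows "prob (t -` {q} \<inter> space M) = 1 / fact (card K)"
proof -
  have "prob (t -` {q} \<inter> space M) = measure (distr M (count_space {q. q permutes K}) t) {q}"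
    using t q by (intro measure_distr[symmetric]) (auto simp: uniform_shuffle_def)
  also have "\<dots> = 1 / fact (card K)"
    using t q K by (simp add: uniform_shuffle_def measure_uniform_count_measure finite_permutations
      card_permutations[OF refl K])
  finally show ?thesis .
qed

section \<open>Symmetry across consumers and the total profit\<close>

text \<open>Complete data are treated as anonymized data whose shuffle is constantly the identity.\<close>

definition all_shuffle :: "inflow_policy \<Rightarrow> 'a \<Rightarrow> nat \<Rightarrow> nat" where
  "all_shuffle X = (case X of Complete \<Rightarrow> \<lambda>_. id | Anonymized \<Rightarrow> \<tau>)"

definition others_shuffle :: "inflow_policy \<Rightarrow> nat \<Rightarrow> 'a \<Rightarrow> nat \<Rightarrow> nat" where
  "others_shuffle X i = (case X of Complete \<Rightarrow> \<lambda>_. id | Anonymized \<Rightarrow> \<rho> i)"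

lemma inflow_eq: "inflow X = shuffled_info consumers (all_shuffle X)"
  by (cases X) (simp_all add: shuffled_info_def all_shuffle_def)

lemma inflow_without_eq: "inflow_without X i = shuffled_info (consumers - {i}) (others_shuffle X i)"
  by (cases X) (simp_all add: shuffled_info_def others_shuffle_def)

lemma independent_all_shuffle: "independent_shuffle consumers (all_shuffle X)"
  using independent_shuffle_id independent_shuffle_uniform[OF \<tau>_uniform \<tau>_indep]
  by (cases X) (simp_all add: all_shuffle_def)

lemma independent_others_shuffle:
  assumes "i \<in> consumers"
  shows "independent_shuffle (consumers - {i}) (others_shuffle X i)"
  using independent_shuffle_id independent_shuffle_uniform[OF \<rho>_uniform[OF assms] \<rho>_indep[OF assms]]
  by (cases X) (simp_all add: others_shuffle_def)

lemma conj_involution_eq_id_iff: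
  assumes "\<And>x. p (p x) = x"
  shows "p \<circ> q \<circ> p = id \<longleftrightarrow> q = id"
proof
  assume "p \<circ> q \<circ> p = id"
  then have "p (q (p (p x))) = p x" for x by (simp add: fun_eq_iff)
  then have "p (p (q x)) = p (p x)" for x by (simp add: assms)
  then show "q = id" by (simp add: assms fun_eq_iff)
qed (simp add: fun_eq_iff assms)

text \<open>The transposition of \<open>i\<close> and \<open>j\<close> is the relabelling. The point
  mass at the identity is carried to itself by conjugation. Uniform laws correspond because
  conjugation matches sets of permutations, and leaving out \<open>i\<close> or \<open>j\<close>
  leaves equally many consumers.\<close>

lemma
  assumes i: "i \<in> consumers" and j: "j \<in> consumers"
  shows gain_inflow_eq: "gain i (inflow X) = gain j (inflow X)"
    and gain_inflow_without_eq: "gain i (inflow_without X i) = gain j (inflow_without X j)"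
proof -
  define p where "p = Transposition.transpose i j"
  have p: "p permutes consumers" unfolding p_def by (rule permutes_swap_id[OF i j])
  have pp: "p (p x) = x" for x by (simp add: p_def)
  have p_i: "p i = j" by (simp add: p_def)
  have pC: "p ` consumers = consumers" by (rule permutes_image[OF p])
  have pD: "p ` (consumers - {i}) = consumers - {j}"
    using image_set_diff[OF permutes_inj[OF p], of consumers "{i}"] by (simp only: image_insert image_empty pC p_i)
  have conj_all: "p \<circ> q \<circ> p permutes consumers" if "q permutes consumers" for q
    using permutes_conj_involution[OF pp that] unfolding pC .
  have conj_others: "p \<circ> q \<circ> p permutes consumers - {j}" if "q permutes consumers - {i}" for q
    using permutes_conj_involution[OF pp that] unfolding pD .
  have id_law: "prob ((\<lambda>_. id) -` {q} \<inter> space M) = prob ((\<lambda>_. id) -` {p \<circ> q \<circ> p} \<inter> space M)" for q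
    using conj_involution_eq_id_iff[OF pp, of q] by (intro arg_cong[of _ _ prob]) auto
  have "prob (all_shuffle X -` {q} \<inter> space M) = prob (all_shuffle X -` {p \<circ> q \<circ> p} \<inter> space M)"
    if "q permutes consumers" for q
    using id_law[of q] prob_uniform_shuffle[OF \<tau>_uniform _ that]
      prob_uniform_shuffle[OF \<tau>_uniform _ conj_all[OF that]]
    by (cases X) (simp_all add: all_shuffle_def)
  then show "gain i (inflow X) = gain j (inflow X)"
    using gain_shuffled_info_eq[OF p pp i order_refl independent_all_shuffle, of "all_shuffle X" X]
      independent_all_shuffle[of X] unfolding inflow_eq pC p_i by blast
  have "prob (others_shuffle X i -` {q} \<inter> space M) = prob (others_shuffle X j -` {p \<circ> q \<circ> p} \<inter> space M)"
    if "q permutes consumers - {i}" for q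
    using id_law[of q] prob_uniform_shuffle[OF \<rho>_uniform[OF i] _ that]
      prob_uniform_shuffle[OF \<rho>_uniform[OF j] _ conj_others[OF that]] i j
    by (cases X) (simp_all add: others_shuffle_def)
  then show "gain i (inflow_without X i) = gain j (inflow_without X j)"
    using gain_shuffled_info_eq[OF p pp i Diff_subset independent_others_shuffle[OF i],
        of "others_shuffle X j" X]
      independent_others_shuffle[OF j, of X] unfolding inflow_without_eq pD p_i by blast
qed

lemma intermediary_profit_eq:
  assumes i: "i \<in> consumers"
  shows "intermediary_profit X = real N * (3 * gain i (inflow_without X i) - gain i (inflow X)) / 8"
proof -
  have "producer_profit j (join_info (own_info j) (inflow X)) (inflow X)
      - producer_profit j (own_info j) (no_info M) - consumer_payment X j =
      (3 * gain i (inflow_without X i) - gain i (inflow X)) / 8" (is "?l = ?r") if j: "j \<in> consumers" for j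
  proof -
    note t = independent_all_shuffle[of X] and r = independent_others_shuffle[OF j, of X]
    have own: "subalgebra M (own_info j)"
      unfolding own_info_def by (rule subalgebra_vimage_algebra[OF signal_measurable[OF j]])
    have none: "subalgebra (own_info j) (no_info M)"
      by (rule subalgebra_no_info) (simp add: own_info_def)
    \<comment> \<open>The consumer's own gains cancel. The gain of the full inflow enters with 1/4
      from profit and -3/8 from compensation, that of the reduced inflow with 3/8. The constants in
      \<mu> and c cancel between each payoff and its benchmark.\<close>
    have "?l = (3 * gain j (inflow_without X j) - gain j (inflow X)) / 8"
      unfolding consumer_payment_def inflow_eq inflow_without_eq
        producer_profit_eq[OF subalgebra_own_join[OF t order_refl j] subalgebra_join[OF t order_refl j] j]
        consumer_surplus_eq[OF subalgebra_own_join[OF t order_refl j] subalgebra_join[OF t order_refl j] j]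
        consumer_surplus_eq[OF subalgebra_own_join[OF r Diff_subset j] subalgebra_join[OF r Diff_subset j] j]
        producer_profit_eq[OF own none j] gain_no_info[OF j] gain_own_join_eq[OF t r j]
      by (simp add: field_simps)
    then show ?thesis
      by (simp only: gain_inflow_eq[OF j i] gain_inflow_without_eq[OF j i])
  qed
  then have "intermediary_profit X =
      (\<Sum>j\<in>consumers. (3 * gain i (inflow_without X i) - gain i (inflow X)) / 8)"
    unfolding intermediary_profit_def producer_payment_def sum_subtractf[symmetric]
    by (intro sum.cong) auto
  then show ?thesis by simp
qed

end

theorem proposition2:
  fixes M :: "'a measure"
    and N :: nat
    and w e :: "nat \<Rightarrow> 'a \<Rightarrow> real"
    and \<mu> \<sigma> c :: real
    and \<tau> :: "'a \<Rightarrow> nat \<Rightarrow> nat"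
    and \<rho> :: "nat \<Rightarrow> 'a \<Rightarrow> nat \<Rightarrow> nat"
    and X :: inflow_policy
    and i :: nat
  assumes "data_market M N w e \<mu> \<sigma> c \<tau> \<rho>"
    and "i \<in> {1..N}"
  shows "data_market.intermediary_profit M N w e \<sigma> c \<tau> \<rho> X \<ge> 0 \<longleftrightarrow>
    3 * data_market.gain M w i (data_market.inflow_without M N w e \<sigma> \<rho> X i)
      \<ge> data_market.gain M w i (data_market.inflow M N w e \<sigma> \<tau> X)"
proof -
  interpret data_market M N w e \<mu> \<sigma> c \<tau> \<rho> by fact
  show ?thesis
    using N_ge_2 unfolding intermediary_profit_eq[OF assms(2)] by (simp add: zero_le_mult_iff)
qed

end
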